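(* For all grim reaper hyperplanes $\Gamma\times\mathbf{R}^{n-1}\subset\mathbf{R}^{n+1}$ ($n\ge1$), one has $\mu_1(\Gamma\times\mathbf{R}^{n-1})=0$.
   Context: $\Gamma$ is the grim reaper curve, the graph of $u(x)=-\log\cos x$, $x\in(-\pi/2,\pi/2)$. The grim reaper hyperplane $\Gamma\times\mathbf{R}^{n-1}$ is the hypersurface in $\mathbf{R}^{n+1}$ given, with the vertical direction of $\Gamma$ being the $x_{n+1}$-direction, by $\{(x_1,\dots,x_{n+1}): x_1\in(-\pi/2,\pi/2),\ x_{n+1}=-\log\cos x_1\}$. It is a translator, i.e. it satisfies $H=-\langle\mathbf{E}_{n+1},\mathbf{n}\rangle$, where $\mathbf{n}$ is the unit normal and $H=\mathrm{div}_\Sigma\mathbf{n}$. For a translator $\Sigma^n\subset\mathbf{R}^{n+1}$ the bottom of the spectrum of the stability operator $L=\Delta+\langle\mathbf{E}_{n+1},\nabla\cdot\rangle+|A|^2$ is $$\mu_1(\Sigma)=\inf_f\frac{\int_\Sigma\big(|\nabla f|^2-|A|^2f^2\big)e^{x_{n+1}}\,d\mu}{\int_\Sigma f^2e^{x_{n+1}}\,d\mu},$$ the infimum being over all (not identically zero) smooth functions $f$ on $\Sigma$ with compact support. Here $A$ is the second fundamental form, $\nabla$ and $\Delta$ are the gradient and Laplacian of $\Sigma$, $d\mu$ is the area measure, and $x_{n+1}$ is the $(n+1)$-th coordinate of the position vector. *)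

theory Defs
  imports "HOL-Analysis.Analysis"
begin

text \<open>
  Geometry of a hypersurface \<open>\<Sigma>\<close> given as a subset of Euclidean space.  The constants below carry
  their usual meaning when \<open>\<Sigma>\<close> is a smooth embedded submanifold (of codimension one where a unit
  normal is involved); no such condition is built into the definitions.
\<close>

section \<open>Smooth maps\<close>

primrec Ck_on :: "nat \<Rightarrow> 'a::real_normed_vector set \<Rightarrow> ('a \<Rightarrow> 'b::real_normed_vector) \<Rightarrow> bool" where
  "Ck_on 0 U f \<longleftrightarrow> continuous_on U f"
| "Ck_on (Suc k) U f \<longleftrightarrow>
     (\<forall>x\<in>U. f differentiable (at x)) \<and> (\<forall>v. Ck_on k U (\<lambda>x. frechet_derivative f (at x) v))"

text \<open>Only used for open \<open>U\<close>.\<close>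

definition smooth_on :: "'a::real_normed_vector set \<Rightarrow> ('a \<Rightarrow> 'b::real_normed_vector) \<Rightarrow> bool" where
  "smooth_on U f \<longleftrightarrow> (\<forall>k. Ck_on k U f)"

text \<open>Smoothness of a map defined on a submanifold: locally it extends smoothly to the ambient space.\<close>

definition smooth_map_on ::
  "'a::euclidean_space set \<Rightarrow> ('a \<Rightarrow> 'b::real_normed_vector) \<Rightarrow> bool" where
  "smooth_map_on \<Sigma> f \<longleftrightarrow>
     (\<forall>p\<in>\<Sigma>. \<exists>U g. open U \<and> p \<in> U \<and> smooth_on U g \<and> (\<forall>x\<in>U \<inter> \<Sigma>. f x = g x))"

section \<open>Tangent spaces, differentials, gradients\<close>

definition curve_in :: "'a::euclidean_space set \<Rightarrow> 'a \<Rightarrow> 'a \<Rightarrow> (real \<Rightarrow> 'a) \<Rightarrow> bool" where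
  "curve_in \<Sigma> p v c \<longleftrightarrow>
     c 0 = p \<and> (c has_vector_derivative v) (at 0) \<and>
     (\<exists>e>0. smooth_on {-e<..<e} c \<and> c ` {-e<..<e} \<subseteq> \<Sigma>)"

definition tangent_space :: "'a::euclidean_space set \<Rightarrow> 'a \<Rightarrow> 'a set" where
  "tangent_space \<Sigma> p = {v. \<exists>c. curve_in \<Sigma> p v c}"

text \<open>The differential of \<open>F\<close> at \<open>p\<close> along \<open>\<Sigma>\<close>, applied to a tangent vector \<open>v\<close>.\<close>

definition surface_deriv ::
  "'a::euclidean_space set \<Rightarrow> ('a \<Rightarrow> 'b::real_normed_vector) \<Rightarrow> 'a \<Rightarrow> 'a \<Rightarrow> 'b" where
  "surface_deriv \<Sigma> F p v =
     (THE w. \<forall>c. curve_in \<Sigma> p v c \<longrightarrow> ((F \<circ> c) has_vector_derivative w) (at 0))"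

definition surface_gradient :: "'a::euclidean_space set \<Rightarrow> ('a \<Rightarrow> real) \<Rightarrow> 'a \<Rightarrow> 'a" where
  "surface_gradient \<Sigma> f p =
     (THE w. w \<in> tangent_space \<Sigma> p \<and> (\<forall>v\<in>tangent_space \<Sigma> p. w \<bullet> v = surface_deriv \<Sigma> f p v))"

section \<open>The second fundamental form\<close>

definition unit_normal_field :: "'a::euclidean_space set \<Rightarrow> ('a \<Rightarrow> 'a) \<Rightarrow> bool" where
  "unit_normal_field \<Sigma> \<nu> \<longleftrightarrow>
     smooth_map_on \<Sigma> \<nu> \<and> (\<forall>p\<in>\<Sigma>. norm (\<nu> p) = 1 \<and> (\<forall>v\<in>tangent_space \<Sigma> p. \<nu> p \<bullet> v = 0))"

text \<open>
  The sign is the one for which the mean curvature, the trace of the second fundamental form, is the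
  divergence of the unit normal along \<open>\<Sigma>\<close>.
\<close>

definition second_fundamental_form ::
  "'a::euclidean_space set \<Rightarrow> ('a \<Rightarrow> 'a) \<Rightarrow> 'a \<Rightarrow> 'a \<Rightarrow> 'a \<Rightarrow> real" where
  "second_fundamental_form \<Sigma> \<nu> p v w = surface_deriv \<Sigma> \<nu> p v \<bullet> w"

definition orthonormal_basis_of :: "'a::euclidean_space set \<Rightarrow> 'a set \<Rightarrow> bool" where
  "orthonormal_basis_of T B \<longleftrightarrow> pairwise orthogonal B \<and> (\<forall>b\<in>B. norm b = 1) \<and> span B = T"

text \<open>
  The squared norm of the second fundamental form at \<open>p\<close>.  It depends neither on the choice of the
  unit normal near \<open>p\<close>, which is unique up to sign, nor on that of the orthonormal basis.
\<close>

definition second_ff_norm_sq :: "'a::euclidean_space set \<Rightarrow> 'a \<Rightarrow> real" where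
  "second_ff_norm_sq \<Sigma> p =
     (let \<nu> = (SOME \<nu>. \<exists>U. open U \<and> p \<in> U \<and> unit_normal_field (\<Sigma> \<inter> U) \<nu>);
          B = (SOME B. orthonormal_basis_of (tangent_space \<Sigma> p) B)
      in \<Sum>v\<in>B. \<Sum>w\<in>B. (second_fundamental_form \<Sigma> \<nu> p v w)\<^sup>2)"

section \<open>The area measure\<close>

definition local_parametrization ::
  "'a::euclidean_space set \<Rightarrow> (real^'n) set \<Rightarrow> (real^'n \<Rightarrow> 'a) \<Rightarrow> bool" where
  "local_parametrization \<Sigma> U \<phi> \<longleftrightarrow>
     open U \<and> smooth_on U \<phi> \<and> (\<forall>u\<in>U. inj (frechet_derivative \<phi> (at u))) \<and>
     openin (top_of_set \<Sigma>) (\<phi> ` U) \<and> (\<exists>\<psi>. homeomorphism U (\<phi> ` U) \<phi> \<psi>)"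

definition metric_matrix :: "(real^'n \<Rightarrow> 'a::euclidean_space) \<Rightarrow> real^'n \<Rightarrow> real^'n^'n" where
  "metric_matrix \<phi> u =
     (\<chi> i j. frechet_derivative \<phi> (at u) (axis i 1) \<bullet> frechet_derivative \<phi> (at u) (axis j 1))"

text \<open>
  The \<open>n\<close>-dimensional area of an \<open>n\<close>-dimensional submanifold \<open>\<Sigma>\<close> is the Borel measure on \<open>\<Sigma>\<close> which in
  every local parametrization has the density \<open>sqrt (det g)\<close>, \<open>g\<close> being the metric matrix.  The
  dimension is the one of the parameter space and is passed as a type argument.
\<close>

definition is_area_measure ::
  "'n::finite itself \<Rightarrow> 'a::euclidean_space set \<Rightarrow> 'a measure \<Rightarrow> bool" where
  "is_area_measure _ \<Sigma> \<mu> \<longleftrightarrow>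
     sets \<mu> = sets (restrict_space borel \<Sigma>) \<and>
     (\<forall>U \<phi>. local_parametrization \<Sigma> U (\<phi> :: real^'n \<Rightarrow> 'a) \<longrightarrow>
        (\<forall>E. E \<in> sets borel \<and> E \<subseteq> U \<longrightarrow>
           emeasure \<mu> (\<phi> ` E) = (\<integral>\<^sup>+u\<in>E. ennreal (sqrt (det (metric_matrix \<phi> u))) \<partial>lborel)))"

definition area_measure :: "'n::finite itself \<Rightarrow> 'a::euclidean_space set \<Rightarrow> 'a measure" where
  "area_measure n \<Sigma> = (THE \<mu>. is_area_measure n \<Sigma> \<mu>)"

section \<open>The bottom of the spectrum of the stability operator\<close>

text \<open>
  From here on the ambient space, of dimension \<open>n + 1\<close>, is the product of the \<open>n\<close>-dimensional
  \<open>real^'n\<close> with the vertical axis \<open>real\<close>; so \<open>n = CARD('n) \<ge> 1\<close>, and the last coordinate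
  of \<open>p\<close> is \<open>snd p\<close>.
\<close>

definition test_function :: "'a::euclidean_space set \<Rightarrow> ('a \<Rightarrow> real) \<Rightarrow> bool" where
  "test_function \<Sigma> f \<longleftrightarrow>
     smooth_map_on \<Sigma> f \<and> compact (\<Sigma> \<inter> closure {p\<in>\<Sigma>. f p \<noteq> 0}) \<and> (\<exists>p\<in>\<Sigma>. f p \<noteq> 0)"

definition rayleigh_quotient ::
  "((real^'n::finite) \<times> real) set \<Rightarrow> ((real^'n) \<times> real \<Rightarrow> real) \<Rightarrow> real" where
  "rayleigh_quotient \<Sigma> f =
     (\<integral>p. ((norm (surface_gradient \<Sigma> f p))\<^sup>2 - second_ff_norm_sq \<Sigma> p * (f p)\<^sup>2) * exp (snd p)
        \<partial>area_measure TYPE('n) \<Sigma>) /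
     (\<integral>p. (f p)\<^sup>2 * exp (snd p) \<partial>area_measure TYPE('n) \<Sigma>)"

text \<open>The infimum is taken in \<open>ereal\<close>, so that it is meaningful also when it is \<open>-\<infinity>\<close>.\<close>

definition spectrum_bottom :: "((real^'n::finite) \<times> real) set \<Rightarrow> ereal" where
  "spectrum_bottom \<Sigma> = (INF f \<in> {f. test_function \<Sigma> f}. ereal (rayleigh_quotient \<Sigma> f))"

section \<open>Grim reaper hyperplanes\<close>

definition grim_reaper_curve :: "(real \<times> real) set" where
  "grim_reaper_curve = {(x, - ln (cos x)) | x. x \<in> {- pi / 2 <..< pi / 2}}"

text \<open>The index \<open>i\<close> names the horizontal coordinate that is listed first.\<close>

definition grim_reaper_hyperplane :: "'n::finite \<Rightarrow> ((real^'n) \<times> real) set" where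
  "grim_reaper_hyperplane i = {(x, z). (x $ i, z) \<in> grim_reaper_curve}"

end

theory Submission
  imports Defs
begin

text \<open>
  In the graph coordinates \<open>x \<mapsto> (x, - ln (cos x\<^sub>i))\<close> over the slab \<open>\<bar>x\<^sub>i\<bar> < \<pi>/2\<close> the area density is
  \<open>1 / cos x\<^sub>i\<close>, \<open>|A|\<^sup>2 = cos\<^sup>2 x\<^sub>i\<close>, and with \<open>F\<close> the coordinate expression of \<open>f\<close> the numerator of
  the Rayleigh quotient becomes
  \<open>\<integral> (\<Sum>j\<noteq>i. (\<partial>\<^sub>j F)\<^sup>2) / cos\<^sup>2 x\<^sub>i + (\<partial>\<^sub>i F)\<^sup>2 - F\<^sup>2\<close>.
  Completing the square with the positive Jacobi field \<open>cos x\<^sub>i\<close> shows that it is nonnegative, and that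
  for \<open>F = cos x\<^sub>i \<eta>\<close> only derivatives of \<open>\<eta>\<close> survive.  Cutting off near the boundary of the slab costs
  little because there the weight \<open>cos\<^sup>2 x\<^sub>i\<close> in front of \<open>(\<partial>\<^sub>i \<eta>)\<^sup>2\<close> is small; cutting off at distance
  \<open>k\<close> in the other directions makes the quotient \<open>O(1/k)\<close>.
\<close>

section \<open>Smooth maps\<close>

text \<open>The Jacobi field \<open>cos x\<^sub>i\<close> comes from vertical translation: up to
  sign it is the last component of the unit normal. For \<open>F = cos x\<^sub>i \<eta>\<close> it
  cancels the weight \<open>1 / cos\<^sup>2 x\<^sub>i\<close> in the denominator, so \<eta> is
  measured by plain Lebesgue measure on a slab of finite width, and the volume growth in the free
  directions is the same in numerator and denominator. The boundary of the slab lies at infinity on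
  the hypersurface, so compact support forces a cut-off there. Its cost is bounded independently of
  the cut-off level and is of order one only on strips of width \<open>1 / k\<close>. A second
  obstacle is the form of the definitions. Gradient, derivative along the hypersurface and area
  measure are definite descriptions, and |A|^2 uses a chosen local normal and a chosen basis. Each
  computation must therefore come with a uniqueness argument, and the area density has to be
  verified in every local parametrization, not only in the graph chart. The latter is what calls for
  a change of variables along arbitrary transition maps.\<close>

lemma Ck_on_cong:
  assumes "open U" "\<And>x. x \<in> U \<Longrightarrow> f x = g x" "Ck_on k U f"
  shows "Ck_on k U g"
  using assms(2,3)
proof (induction k arbitrary: f g)
  case 0
  then show ?case by (auto cong: continuous_on_cong)
next
  case (Suc k)
  have "(g has_derivative frechet_derivative f (at x)) (at x)" if "x \<in> U" for x
  proof (rule has_derivative_transform_within_open[OF _ assms(1) that])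
    show "(f has_derivative frechet_derivative f (at x)) (at x)"
      using Suc.prems(2) that frechet_derivative_works by auto
  qed (use Suc.prems(1) in auto)
  then have g: "g differentiable (at x)" "frechet_derivative f (at x) = frechet_derivative g (at x)"
    if "x \<in> U" for x
    using that by (auto simp: differentiable_def intro: frechet_derivative_at)
  have "Ck_on k U (\<lambda>x. frechet_derivative g (at x) v)" for v
  proof (rule Suc.IH)
    show "Ck_on k U (\<lambda>x. frechet_derivative f (at x) v)" using Suc.prems(2) by simp
  qed (simp add: g(2))
  with g(1) show ?case by simp
qed

text \<open>\<open>frechet_derivative\<close> is a choice operator, so \<open>Ck_on\<close> is
  awkward to unfold on concrete functions. On an open set any explicit derivative may stand in for
  it; the closure proofs for sums, products and compositions run through this rule.\<close>

lemma Ck_on_SucI: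
  assumes "open U" and der: "\<And>x. x \<in> U \<Longrightarrow> (f has_derivative f' x) (at x)"
    and "\<And>v. Ck_on k U (\<lambda>x. f' x v)"
  shows "Ck_on (Suc k) U f"
proof -
  have "Ck_on k U (\<lambda>x. frechet_derivative f (at x) v)" for v
    by (rule Ck_on_cong[OF assms(1) _ assms(3)]) (simp add: frechet_derivative_at[OF der, symmetric])
  then show ?thesis
    using der by (auto simp: differentiable_def)
qed

lemma Ck_on_Suc_derivative:
  assumes "Ck_on (Suc k) U f"
  shows "\<exists>f'. (\<forall>x\<in>U. (f has_derivative f' x) (at x)) \<and> (\<forall>v. Ck_on k U (\<lambda>x. f' x v))"
  using assms frechet_derivative_works
  by (intro exI[of _ "\<lambda>x. frechet_derivative f (at x)"]) (simp add: frechet_derivative_works)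

lemma Ck_on_SucD: "Ck_on (Suc k) U f \<Longrightarrow> Ck_on k U f"
proof (induction k arbitrary: f)
  case 0
  then show ?case
    by (auto intro!: continuous_at_imp_continuous_on differentiable_imp_continuous_within)
next
  case (Suc k)
  have "Ck_on k U (\<lambda>x. frechet_derivative f (at x) v)" for v
    using Suc.prems unfolding Ck_on.simps(2)[of "Suc k"] by (blast intro: Suc.IH)
  with Suc.prems show ?case unfolding Ck_on.simps(2) by blast
qed

lemma Ck_on_subset: "Ck_on k U f \<Longrightarrow> V \<subseteq> U \<Longrightarrow> Ck_on k V f"
  by (induction k arbitrary: f) (simp add: continuous_on_subset, simp, blast)

lemma Ck_on_const: "Ck_on k U (\<lambda>x. c)"
  by (induction k arbitrary: c) (auto simp: frechet_derivative_const)

lemma Ck_on_bounded_linear_compose: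
  assumes "bounded_linear L" "open U" "Ck_on k U f"
  shows "Ck_on k U (\<lambda>x. L (f x))"
  using assms(3)
proof (induction k arbitrary: f)
  case 0
  then show ?case using assms(1) by (auto intro: bounded_linear.continuous_on)
next
  case (Suc k)
  obtain f' where f': "\<And>x. x \<in> U \<Longrightarrow> (f has_derivative f' x) (at x)" "\<And>v. Ck_on k U (\<lambda>x. f' x v)"
    using Ck_on_Suc_derivative[OF Suc.prems] by blast
  show ?case
    by (intro Ck_on_SucI[OF assms(2), where f' = "\<lambda>x v. L (f' x v)"] f'
        bounded_linear.has_derivative[OF assms(1)] Suc.IH)
qed

lemma Ck_on_bounded_linear:
  assumes "bounded_linear L" "open U"
  shows "Ck_on k U L"
proof (cases k)
  case 0
  then show ?thesis using assms by (auto intro: linear_continuous_on)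
next
  case (Suc m)
  have "Ck_on (Suc m) U L"
    by (rule Ck_on_SucI[where f' = "\<lambda>_. L"])
      (auto intro: Ck_on_const assms bounded_linear_imp_has_derivative)
  then show ?thesis by (simp only: Suc)
qed

lemma Ck_on_add:
  assumes "open U" "Ck_on k U f" "Ck_on k U g"
  shows "Ck_on k U (\<lambda>x. f x + g x)"
  using assms(2,3)
proof (induction k arbitrary: f g)
  case 0
  then show ?case by (auto intro: continuous_intros)
next
  case (Suc k)
  obtain f' where f': "\<And>x. x \<in> U \<Longrightarrow> (f has_derivative f' x) (at x)" "\<And>v. Ck_on k U (\<lambda>x. f' x v)"
    using Ck_on_Suc_derivative[OF Suc.prems(1)] by blast
  obtain g' where g': "\<And>x. x \<in> U \<Longrightarrow> (g has_derivative g' x) (at x)" "\<And>v. Ck_on k U (\<lambda>x. g' x v)"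
    using Ck_on_Suc_derivative[OF Suc.prems(2)] by blast
  show ?case
    using f' g' by (intro Ck_on_SucI[OF assms(1), where f' = "\<lambda>x v. f' x v + g' x v"]
        has_derivative_add Suc.IH)
qed

lemma Ck_on_sum:
  assumes "open U" "\<And>i. i \<in> I \<Longrightarrow> Ck_on k U (f i)"
  shows "Ck_on k U (\<lambda>x. \<Sum>i\<in>I. f i x)"
  using assms(2)
  by (induction I rule: infinite_finite_induct) (auto intro: Ck_on_add Ck_on_const assms(1))

lemma Ck_on_scaleR:
  assumes "open U" "Ck_on k U f" "Ck_on k U g"
  shows "Ck_on k U (\<lambda>x. f x *\<^sub>R g x)"
  using assms(2,3)
proof (induction k arbitrary: f g)
  case 0
  then show ?case by (auto intro: continuous_intros)
next
  case (Suc k)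
  obtain f' where f': "\<And>x. x \<in> U \<Longrightarrow> (f has_derivative f' x) (at x)" "\<And>v. Ck_on k U (\<lambda>x. f' x v)"
    using Ck_on_Suc_derivative[OF Suc.prems(1)] by blast
  obtain g' where g': "\<And>x. x \<in> U \<Longrightarrow> (g has_derivative g' x) (at x)" "\<And>v. Ck_on k U (\<lambda>x. g' x v)"
    using Ck_on_Suc_derivative[OF Suc.prems(2)] by blast
  show ?case
    using f' g' Suc.prems[THEN Ck_on_SucD]
    by (intro Ck_on_SucI[OF assms(1), where f' = "\<lambda>x v. f x *\<^sub>R g' x v + f' x v *\<^sub>R g x"]
        has_derivative_scaleR Suc.IH Ck_on_add assms(1)) auto
qed

text \<open>\<open>Ck_on\<close> differentiates in a fixed direction, whereas the chain rule
  evaluates \<open>f' (g x)\<close> in the direction \<open>g' x v\<close>, which moves with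
  \<open>x\<close>. Expanding that direction in the basis of the middle space leaves fixed
  directions \<open>b\<close> with scalar coefficients, to which the induction hypothesis and the
  product rule apply.\<close>

lemma Ck_on_compose:
  fixes g :: "'a::real_normed_vector \<Rightarrow> 'b::euclidean_space"
  assumes "open U" "open V" "g ` U \<subseteq> V" "Ck_on k V f" "Ck_on k U g"
  shows "Ck_on k U (\<lambda>x. f (g x))"
  using assms(4,5)
proof (induction k arbitrary: f)
  case 0
  then show ?case using assms(3) by (auto intro: continuous_on_compose2)
next
  case (Suc k)
  obtain f' where f': "\<And>x. x \<in> V \<Longrightarrow> (f has_derivative f' x) (at x)" "\<And>v. Ck_on k V (\<lambda>x. f' x v)"
    using Ck_on_Suc_derivative[OF Suc.prems(1)] by blast
  obtain g' where g': "\<And>x. x \<in> U \<Longrightarrow> (g has_derivative g' x) (at x)" "\<And>v. Ck_on k U (\<lambda>x. g' x v)"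
    using Ck_on_Suc_derivative[OF Suc.prems(2)] by blast
  show ?case
  proof (rule Ck_on_SucI[OF assms(1), where f' = "\<lambda>x v. \<Sum>b\<in>Basis. (g' x v \<bullet> b) *\<^sub>R f' (g x) b"])
    show "Ck_on k U (\<lambda>x. \<Sum>b\<in>Basis. (g' x v \<bullet> b) *\<^sub>R f' (g x) b)" for v
      using f' g' Suc.prems(2)[THEN Ck_on_SucD]
      by (intro Ck_on_sum Ck_on_scaleR Suc.IH assms(1)
          Ck_on_bounded_linear_compose[OF bounded_linear_inner_left])
  next
    fix x assume x: "x \<in> U"
    with assms(3) have f: "(f has_derivative f' (g x)) (at (g x))" by (auto intro: f')
    interpret linear "f' (g x)" using f by (rule has_derivative_linear)
    have "f' (g x) (g' x v) = (\<Sum>b\<in>Basis. (g' x v \<bullet> b) *\<^sub>R f' (g x) b)" for v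
      using arg_cong[OF euclidean_representation[of "g' x v"], of "f' (g x)"]
      by (simp add: sum scaleR)
    then show "((\<lambda>x. f (g x)) has_derivative (\<lambda>v. \<Sum>b\<in>Basis. (g' x v \<bullet> b) *\<^sub>R f' (g x) b)) (at x)"
      using has_derivative_compose[OF g'(1)[OF x] f] by simp
  qed
qed

lemma smooth_onD_continuous: "smooth_on U f \<Longrightarrow> continuous_on U f"
  unfolding smooth_on_def by (metis Ck_on.simps(1))

lemma smooth_on_derivative:
  assumes "smooth_on U f"
  shows "\<exists>f'. (\<forall>x\<in>U. (f has_derivative f' x) (at x)) \<and> (\<forall>v. continuous_on U (\<lambda>x. f' x v))"
proof -
  from assms have "Ck_on (Suc 0) U f" unfolding smooth_on_def by blast
  from Ck_on_Suc_derivative[OF this] show ?thesis by simp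
qed

lemma smooth_on_subset: "smooth_on U f \<Longrightarrow> V \<subseteq> U \<Longrightarrow> smooth_on V f"
  unfolding smooth_on_def by (blast intro: Ck_on_subset)

lemma smooth_on_const: "smooth_on U (\<lambda>x. c)"
  unfolding smooth_on_def by (blast intro: Ck_on_const)

lemma smooth_on_bounded_linear: "bounded_linear L \<Longrightarrow> open U \<Longrightarrow> smooth_on U L"
  unfolding smooth_on_def by (blast intro: Ck_on_bounded_linear)

lemma smooth_on_add: "open U \<Longrightarrow> smooth_on U f \<Longrightarrow> smooth_on U g \<Longrightarrow> smooth_on U (\<lambda>x. f x + g x)"
  unfolding smooth_on_def by (blast intro: Ck_on_add)

lemma smooth_on_sum:
  "open U \<Longrightarrow> (\<And>i. i \<in> I \<Longrightarrow> smooth_on U (f i)) \<Longrightarrow> smooth_on U (\<lambda>x. \<Sum>i\<in>I. f i x)"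
  unfolding smooth_on_def by (blast intro: Ck_on_sum)

lemma smooth_on_scaleR:
  "open U \<Longrightarrow> smooth_on U f \<Longrightarrow> smooth_on U g \<Longrightarrow> smooth_on U (\<lambda>x. f x *\<^sub>R g x)"
  unfolding smooth_on_def by (blast intro: Ck_on_scaleR)

lemma smooth_on_mult:
  fixes f g :: "'a::real_normed_vector \<Rightarrow> real"
  shows "open U \<Longrightarrow> smooth_on U f \<Longrightarrow> smooth_on U g \<Longrightarrow> smooth_on U (\<lambda>x. f x * g x)"
  using smooth_on_scaleR[of U f g] by simp

lemma smooth_on_compose:
  fixes g :: "'a::real_normed_vector \<Rightarrow> 'b::euclidean_space"
  shows "open U \<Longrightarrow> open V \<Longrightarrow> g ` U \<subseteq> V \<Longrightarrow> smooth_on V f \<Longrightarrow> smooth_on U g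
    \<Longrightarrow> smooth_on U (\<lambda>x. f (g x))"
  unfolding smooth_on_def by (blast intro: Ck_on_compose)

text \<open>\<open>smooth_map_on\<close> supplies a smooth extension near each point only; this
  glues the pieces after pulling back to the slab.\<close>

lemma Ck_on_locally:
  assumes "\<And>x. x \<in> U \<Longrightarrow> \<exists>V. open V \<and> x \<in> V \<and> Ck_on k V f"
  shows "Ck_on k U f"
  using assms
proof (induction k arbitrary: f)
  case 0
  have "isCont f x" if x: "x \<in> U" for x
  proof -
    obtain V where "open V" "x \<in> V" "continuous_on V f"
      using 0[OF x] by auto
    then show ?thesis using continuous_on_eq_continuous_at by blast
  qed
  then show ?case by (simp add: continuous_at_imp_continuous_on)
next
  case (Suc k)
  note local = Suc.prems[unfolded Ck_on.simps(2)]
  have "Ck_on k U (\<lambda>x. frechet_derivative f (at x) v)" for v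
  proof (rule Suc.IH)
    fix x assume "x \<in> U"
    from local[OF this] show "\<exists>V. open V \<and> x \<in> V \<and> Ck_on k V (\<lambda>x. frechet_derivative f (at x) v)"
      by meson
  qed
  moreover have "f differentiable (at x)" if "x \<in> U" for x
    using local[OF that] by meson
  ultimately show ?case unfolding Ck_on.simps(2) by blast
qed

lemma smooth_on_locally:
  assumes "\<And>x. x \<in> U \<Longrightarrow> \<exists>V. open V \<and> x \<in> V \<and> smooth_on V f"
  shows "smooth_on U f"
  unfolding smooth_on_def
proof (intro allI Ck_on_locally)
  fix k x assume "x \<in> U"
  from assms[OF this] obtain V where "open V" "x \<in> V" "smooth_on V f" by blast
  then show "\<exists>V. open V \<and> x \<in> V \<and> Ck_on k V f"
    unfolding smooth_on_def by (intro exI[of _ V]) simp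
qed

lemma smooth_on_cong:
  assumes "open U" "\<And>x. x \<in> U \<Longrightarrow> f x = g x" "smooth_on U f"
  shows "smooth_on U g"
  unfolding smooth_on_def
proof
  show "Ck_on k U g" for k
    by (rule Ck_on_cong[OF assms(1,2)]) (use assms(3) in \<open>simp_all add: smooth_on_def\<close>)
qed

text \<open>The induction on the order of differentiability moves from \<open>f\<close> to its
  derivative, which is again in the family. One derivative computation per family thus gives all
  orders at once.\<close>

lemma smooth_on_real_family:
  fixes F :: "(real \<Rightarrow> real) set"
  assumes "open U" and der: "\<And>f. f \<in> F \<Longrightarrow> \<exists>f'\<in>F. \<forall>x\<in>U. (f has_real_derivative f' x) (at x)"
    and "f \<in> F"
  shows "smooth_on U f"
proof -
  have "Ck_on k U f" for k
    using assms(3)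
  proof (induction k arbitrary: f)
    case 0
    with der show ?case
      by (fastforce intro!: continuous_at_imp_continuous_on intro: DERIV_isCont)
  next
    case (Suc k)
    then obtain f' where f': "f' \<in> F" "\<And>x. x \<in> U \<Longrightarrow> (f has_real_derivative f' x) (at x)"
      using der by metis
    show ?case
    proof (rule Ck_on_SucI[OF assms(1), where f' = "\<lambda>x v. v *\<^sub>R f' x"])
      show "(f has_derivative (\<lambda>v. v *\<^sub>R f' x)) (at x)" if "x \<in> U" for x
        using f'(2)[OF that] by (simp add: has_field_derivative_def mult.commute[of _ "f' x"])
      show "Ck_on k U (\<lambda>x. v *\<^sub>R f' x)" for v
        by (rule Ck_on_bounded_linear_compose[OF bounded_linear_scaleR_right assms(1)
              Suc.IH[OF f'(1)]])
    qed
  qed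
  then show ?thesis unfolding smooth_on_def by blast
qed

section \<open>Smoothness of cosine, sine and logarithm\<close>

lemma smooth_on_cos: "smooth_on UNIV (cos :: real \<Rightarrow> real)"
  and smooth_on_sin: "smooth_on UNIV (sin :: real \<Rightarrow> real)"
proof -
  let ?F = "{sin, cos, \<lambda>x. - sin x, \<lambda>x. - cos x} :: (real \<Rightarrow> real) set"
  have "\<exists>f'\<in>?F. \<forall>x\<in>UNIV. (f has_real_derivative f' x) (at x)" if "f \<in> ?F" for f
    using that by (auto intro!: derivative_eq_intros)
  note family = smooth_on_real_family[OF open_UNIV this]
  show "smooth_on UNIV (cos :: real \<Rightarrow> real)" by (rule family) auto
  show "smooth_on UNIV (sin :: real \<Rightarrow> real)" by (rule family) auto
qed

lemma smooth_on_ln: "smooth_on {0<..} (ln :: real \<Rightarrow> real)"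
proof -
  \<comment> \<open>From the first derivative on, only multiples of negative powers occur; admitting
    every real \<open>c\<close> and natural \<open>k\<close> keeps the family closed.\<close>
  let ?F = "insert ln (range (\<lambda>(c, k). \<lambda>x. c / x ^ k)) :: (real \<Rightarrow> real) set"
  have der: "\<exists>f'\<in>?F. \<forall>x\<in>{0<..}. (f has_real_derivative f' x) (at x)" if f: "f \<in> ?F" for f
  proof (cases "f = ln")
    case True
    have mem: "(\<lambda>x::real. 1 / x ^ 1) \<in> ?F" by (rule insertI2) (rule image_eqI[of _ _ "(1, 1)"], auto)
    have "\<forall>x\<in>{0<..}. (f has_real_derivative 1 / x ^ 1) (at x)"
      unfolding True by (auto intro!: derivative_eq_intros)
    then show ?thesis by (rule bexI[OF _ mem])
  next
    case False
    with f obtain c k where fck: "f = (\<lambda>x. c / x ^ k)" by auto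
    have mem: "(\<lambda>x::real. (- (c * k)) / x ^ (k + 1)) \<in> ?F"
      by (rule insertI2) (rule image_eqI[of _ _ "(- (c * k), k + 1)"], auto)
    have "\<forall>x\<in>{0<..}. (f has_real_derivative (- (c * k)) / x ^ (k + 1)) (at x)"
      unfolding fck
    proof (cases k)
      case (Suc n)
      have "((\<lambda>x. c / x ^ k) has_real_derivative (- (c * k)) / x ^ (k + 1)) (at x)" if "x > 0" for x
      proof -
        have "((\<lambda>x. x ^ k) has_real_derivative k * x ^ n) (at x)"
          using DERIV_pow[of k x] Suc by simp
        from DERIV_divide[OF DERIV_const this, of c] that show ?thesis
          by (rule_tac DERIV_cong) (auto simp: Suc field_simps)
      qed
      then show "\<forall>x\<in>{0<..}. ((\<lambda>x. c / x ^ k) has_real_derivative (- (c * k)) / x ^ (k + 1)) (at x)"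
        by simp
    qed (auto intro!: derivative_eq_intros)
    then show ?thesis by (rule bexI[OF _ mem])
  qed
  show ?thesis by (rule smooth_on_real_family[OF open_greaterThan der]) auto
qed

section \<open>A smooth function vanishing on the negative half-line\<close>

text \<open>The shape of all derivatives of \<open>exp (- (1 / t))\<close> for positive
  \<open>t\<close>; polynomials in \<open>1 / t\<close> make the family closed under
  differentiation.\<close>

definition flat_exp_poly :: "real poly \<Rightarrow> real \<Rightarrow> real" where
  "flat_exp_poly p t = (if t > 0 then poly p (1 / t) * exp (- (1 / t)) else 0)"

lemma poly_mult_exp_minus_tendsto_0:
  "((\<lambda>u::real. poly p u * exp (- u)) \<longlongrightarrow> 0) at_top"
proof -
  have "((\<lambda>u. \<Sum>i\<le>degree p. coeff p i * (u ^ i / exp u)) \<longlongrightarrow> (\<Sum>i\<le>degree p. coeff p i * 0)) at_top"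
    by (intro tendsto_intros tendsto_power_div_exp_0)
  then show ?thesis
    by (simp add: poly_altdef sum_distrib_right sum_divide_distrib exp_minus field_simps)
qed

text \<open>With \<open>u = 1 / t\<close> one has \<open>du/dt = - u\<^sup>2\<close>, so
  \<open>p(u) exp(-u)\<close> has derivative \<open>u\<^sup>2 (p(u) - p'(u)) exp(-u)\<close>; the
  polynomial \<open>[:0, 0, 1:]\<close> is this \<open>u\<^sup>2\<close>. At 0 the exponential beats
  every power of \<open>u\<close>.\<close>

lemma flat_exp_poly_has_derivative:
  "(flat_exp_poly p has_real_derivative flat_exp_poly ([:0, 0, 1:] * (p - pderiv p)) t) (at t)"
proof -
  consider "t > 0" | "t < 0" | "t = 0" by linarith
  then show ?thesis
  proof cases
    case 1
    have "((\<lambda>t. poly p (1 / t) * exp (- (1 / t))) has_real_derivative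
        flat_exp_poly ([:0, 0, 1:] * (p - pderiv p)) t) (at t)"
      using 1 unfolding flat_exp_poly_def
      by (auto intro!: derivative_eq_intros simp: field_simps power2_eq_square)
    then show ?thesis
      using 1 by (rule_tac has_field_derivative_transform_within_open[where S = "{0<..}"])
        (auto simp: flat_exp_poly_def)
  next
    case 2
    have "((\<lambda>t. 0) has_real_derivative 0) (at t)" by simp
    then show ?thesis
      using 2 by (rule_tac has_field_derivative_transform_within_open[where S = "{..<0}"])
        (auto simp: flat_exp_poly_def)
  next
    case 3
    \<comment> \<open>\<open>pCons 0 p\<close> multiplies \<open>p\<close> by its argument
      \<open>1 / s\<close>, which is the division by \<open>s\<close> in the difference quotient at
      0.\<close>
    have "((\<lambda>s. poly (pCons 0 p) (1 / s) * exp (- (1 / s))) \<longlongrightarrow> 0) (at_right 0)"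
      using filterlim_compose[OF poly_mult_exp_minus_tendsto_0[of "pCons 0 p"] filterlim_inverse_at_top_right]
      by (simp only: inverse_eq_divide)
    then have "((\<lambda>s. flat_exp_poly p s / s) \<longlongrightarrow> 0) (at_right 0)"
      by (rule Lim_transform_eventually)
        (auto simp: flat_exp_poly_def eventually_at_right_less intro!: eventually_at_rightI[of 0 1])
    moreover have "((\<lambda>s. flat_exp_poly p s / s) \<longlongrightarrow> 0) (at_left 0)"
      by (rule Lim_transform_eventually[OF tendsto_const])
        (auto simp: flat_exp_poly_def intro!: eventually_at_leftI[of "-1" 0])
    ultimately have "((\<lambda>s. flat_exp_poly p s / s) \<longlongrightarrow> 0) (at 0)"
      by (rule filterlim_split_at[rotated])
    then show ?thesis
      using 3 by (simp add: DERIV_def flat_exp_poly_def)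
  qed
qed

section \<open>The cut-off profile and its derivative bounds\<close>

definition flat_exp :: "real \<Rightarrow> real" where
  "flat_exp t = (if t > 0 then exp (- (1 / t)) else 0)"

definition flat_exp' :: "real \<Rightarrow> real" where
  "flat_exp' t = (if t > 0 then (1 / t)\<^sup>2 * exp (- (1 / t)) else 0)"

lemma flat_exp_eq: "flat_exp = flat_exp_poly 1"
  by (auto simp: flat_exp_def flat_exp_poly_def)

lemma flat_exp'_eq: "flat_exp' = flat_exp_poly ([:0, 0, 1:] * (1 - pderiv 1))"
  by (auto simp: flat_exp'_def flat_exp_poly_def power2_eq_square)

lemma flat_exp_has_derivative: "(flat_exp has_real_derivative flat_exp' t) (at t)"
  unfolding flat_exp_eq flat_exp'_eq by (rule flat_exp_poly_has_derivative)

lemma smooth_on_flat_exp: "smooth_on UNIV flat_exp"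
  unfolding flat_exp_eq
  by (rule smooth_on_real_family[of UNIV "range flat_exp_poly"])
    (use flat_exp_poly_has_derivative in blast)+

lemma flat_exp_bounds: "0 \<le> flat_exp t" "flat_exp t \<le> 1" "0 \<le> flat_exp' t"
  by (auto simp: flat_exp_def flat_exp'_def)

lemma flat_exp_pos: "t > 0 \<Longrightarrow> flat_exp t > 0"
  by (simp add: flat_exp_def)

lemma flat_exp_mono: "s \<le> t \<Longrightarrow> flat_exp s \<le> flat_exp t"
  by (auto simp: flat_exp_def field_simps)

text \<open>With \<open>t + 1 = cos x\<^sub>i / \<delta>\<close> the product
  \<open>(t + 1) * flat_exp' t\<close> is \<open>cos x\<^sub>i\<close> times the slope of the slab
  cut-off, so its bound does not depend on \<delta>. For \<open>u = 1 / t\<close> it equals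
  \<open>(u + u\<^sup>2) / exp u\<close>, and the quadratic Taylor bound of \<open>exp u\<close>
  suffices.\<close>

lemma flat_exp'_le_2: "t \<ge> 0 \<Longrightarrow> (t + 1) * flat_exp' t \<le> 2" "flat_exp' t \<le> 2"
proof -
  have *: "(t + 1) * flat_exp' t \<le> 2 \<and> flat_exp' t \<le> 2" if t: "t > 0"
  proof -
    define u where "u = 1 / t"
    have u: "u > 0" "t * u\<^sup>2 = u" using t by (auto simp: u_def power2_eq_square)
    have e: "1 + u + u\<^sup>2 / 2 \<le> exp u" using exp_lower_Taylor_quadratic[of u] u by simp
    have f: "flat_exp' t = u\<^sup>2 / exp u"
      using t by (simp add: flat_exp'_def u_def exp_minus divide_inverse)
    moreover have "(t + 1) * flat_exp' t = (u + u\<^sup>2) / exp u"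
      unfolding f using u(2) by (simp add: algebra_simps add_divide_distrib[symmetric])
    moreover have "(u + u\<^sup>2) / exp u \<le> 2" "u\<^sup>2 / exp u \<le> 2"
      using e u(1) by (simp_all add: pos_divide_le_eq)
    ultimately show ?thesis by metis
  qed
  then show "t \<ge> 0 \<Longrightarrow> (t + 1) * flat_exp' t \<le> 2" "flat_exp' t \<le> 2"
    by (cases "t > 0"; simp add: flat_exp'_def)+
qed

text \<open>\<open>flat_exp\<close> keeps increasing towards 1 and never becomes constant on the
  positive axis, so the cut-off has a nonzero slope even in the middle of the slab. This bound makes
  the contribution of that region small.\<close>

lemma flat_exp'_decay:
  assumes "k \<ge> 1" "t \<ge> k"
  shows "(t + 1) * flat_exp' t \<le> 2 / k"
proof -
  define u where "u = 1 / t"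
  have u: "u > 0" "u \<le> 1" "u \<le> 1 / k" "t * u\<^sup>2 = u"
    using assms by (auto simp: u_def power2_eq_square field_simps)
  have "(t + 1) * flat_exp' t = (u + u\<^sup>2) * exp (- u)"
    using assms u(4) by (simp add: flat_exp'_def u_def[symmetric] algebra_simps)
  also have "\<dots> \<le> (u + u\<^sup>2) * 1" using u by (intro mult_left_mono) auto
  also have "\<dots> \<le> 2 * u" using u mult_left_mono[of u 1 u] by (simp add: power2_eq_square)
  also have "\<dots> \<le> 2 / k" using u(3) by simp
  finally show ?thesis .
qed

lemma flat_exp_nonpos [simp]: "t \<le> 0 \<Longrightarrow> flat_exp t = 0" "t \<le> 0 \<Longrightarrow> flat_exp' t = 0"
  by (auto simp: flat_exp_def flat_exp'_def)

lemma flat_exp_has_derivative_compose: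
  assumes "(g has_derivative g') (at x)"
  shows "((\<lambda>x. flat_exp (g x)) has_derivative (\<lambda>v. flat_exp' (g x) * g' v)) (at x)"
  by (rule has_derivative_compose[OF assms, of flat_exp])
    (use flat_exp_has_derivative in \<open>simp add: has_field_derivative_def\<close>)

lemma continuous_on_flat_exp:
  "continuous_on UNIV flat_exp" "continuous_on UNIV flat_exp'"
  unfolding flat_exp_eq flat_exp'_eq
  by (intro continuous_at_imp_continuous_on ballI DERIV_isCont[OF flat_exp_poly_has_derivative])+

section \<open>Change of variables\<close>

text \<open>
  The change of variables formula of the library needs a well-ordered index type, whereas
  the index type of \<open>real^'n\<close> is merely finite here; hence the detour through an ordered copy.
\<close>

typedef 'a enumerated = "UNIV :: 'a set" by simp

instance enumerated :: (finite) finite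
proof
  have "inj (Rep_enumerated :: 'a enumerated \<Rightarrow> 'a)" by (meson Rep_enumerated_inject injI)
  then show "finite (UNIV :: 'a enumerated set)" by (rule finite_imageD[OF finite_subset, rotated 2]) auto
qed

instantiation enumerated :: (finite) wellorder
begin

definition less_eq_enumerated :: "'a enumerated \<Rightarrow> 'a enumerated \<Rightarrow> bool" where
  "x \<le> y \<longleftrightarrow> to_nat_on UNIV (Rep_enumerated x) \<le> to_nat_on UNIV (Rep_enumerated y)"

definition less_enumerated :: "'a enumerated \<Rightarrow> 'a enumerated \<Rightarrow> bool" where
  "x < y \<longleftrightarrow> to_nat_on UNIV (Rep_enumerated x) < to_nat_on UNIV (Rep_enumerated y)"

instance
proof
  have inj: "to_nat_on UNIV a = to_nat_on UNIV b \<longleftrightarrow> a = b" for a b :: 'a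
    by (rule to_nat_on_inj) (auto intro: countable_finite)
  fix x y z :: "'a enumerated"
  show "x \<le> y \<Longrightarrow> y \<le> x \<Longrightarrow> x = y"
    using inj Rep_enumerated_inject unfolding less_eq_enumerated_def by (metis antisym)
  fix P :: "'a enumerated \<Rightarrow> bool" and a :: "'a enumerated"
  assume "\<And>x. (\<And>y. y < x \<Longrightarrow> P y) \<Longrightarrow> P x"
  then show "P a"
    unfolding less_enumerated_def
    by (induction "to_nat_on UNIV (Rep_enumerated a)" arbitrary: a rule: less_induct) blast
qed (auto simp: less_eq_enumerated_def less_enumerated_def)

end

section \<open>Relabelling coordinates: determinants and Lebesgue measure\<close>

lemma bij_Rep_enumerated: "bij Rep_enumerated"
  by (metis bij_betw_def Rep_enumerated_inject injI surjI Abs_enumerated_inverse UNIV_I)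

text \<open>Conjugation by \<open>\<pi>\<close> is a sign-preserving bijection between the
  permutations of the two index types, so the Leibniz sums agree term by term.\<close>

lemma det_reindex:
  fixes A :: "'a::comm_ring_1^'n^'n" and \<pi> :: "'m::finite \<Rightarrow> 'n::finite"
  assumes "bij \<pi>"
  shows "det (\<chi> a b. A $ \<pi> a $ \<pi> b) = det A"
proof -
  have inj: "inj \<pi>" and im: "range \<pi> = UNIV" using assms by (auto simp: bij_def)
  have "det A = (\<Sum>p\<in>{p. p permutes (UNIV :: 'm set)}. of_int (sign (map_permutation UNIV \<pi> p)) *
      (\<Prod>j\<in>UNIV. A $ j $ map_permutation UNIV \<pi> p j))"
    unfolding det_def
    by (rule sum.reindex_bij_betw[symmetric]) (use bij_betw_permutations[of \<pi> UNIV UNIV] assms im in \<open>simp add: map_permutation_def[abs_def] restrict_id_def comp_def\<close>)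
  also have "\<dots> = (\<Sum>p\<in>{p. p permutes (UNIV :: 'm set)}. of_int (sign p) *
      (\<Prod>a\<in>UNIV. A $ \<pi> a $ \<pi> (p a)))"
  proof (rule sum.cong[OF refl])
    fix p :: "'m \<Rightarrow> 'm" assume "p \<in> {p. p permutes UNIV}"
    then have p: "p permutes UNIV" by simp
    have "(\<Prod>j\<in>UNIV. A $ j $ map_permutation UNIV \<pi> p j) =
        (\<Prod>a\<in>UNIV. A $ \<pi> a $ map_permutation UNIV \<pi> p (\<pi> a))"
      by (rule prod.reindex_bij_betw[symmetric, OF assms])
    also have "\<dots> = (\<Prod>a\<in>UNIV. A $ \<pi> a $ \<pi> (p a))"
      by (simp add: map_permutation_apply[OF inj])
    finally show "of_int (sign (map_permutation UNIV \<pi> p)) * (\<Prod>j\<in>UNIV. A $ j $ map_permutation UNIV \<pi> p j) =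
        of_int (sign p) * (\<Prod>a\<in>UNIV. A $ \<pi> a $ \<pi> (p a))"
      by (simp add: sign_map_permutation[OF inj p])
  qed
  also have "\<dots> = det (\<chi> a b. A $ \<pi> a $ \<pi> b)"
    by (simp add: det_def)
  finally show ?thesis ..
qed

text \<open>Lebesgue measure is determined by its values on boxes, and relabelling turns a box into
  a box with the same side lengths.\<close>

lemma lborel_vec_reindex:
  fixes \<pi> :: "'m::finite \<Rightarrow> 'n::finite"
  assumes "bij \<pi>"
  shows "distr lborel borel (\<lambda>x :: real^'n. \<chi> a. x $ \<pi> a) = (lborel :: (real^'m) measure)"
proof (rule lborel_eqI[symmetric])
  let ?f = "\<lambda>x :: real^'n. (\<chi> a. x $ \<pi> a) :: real^'m"
  have cont: "continuous_on UNIV ?f" by (intro continuous_intros)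
  then have meas [measurable]: "?f \<in> borel_measurable borel" by (rule borel_measurable_continuous_onI)
  let ?\<sigma> = "inv \<pi>"
  have \<sigma>: "\<pi> (?\<sigma> j) = j" "?\<sigma> (\<pi> a) = a" for j a
    using assms by (auto simp: bij_def surj_f_inv_f)
  fix l u :: "real^'m" assume lu: "\<And>b. b \<in> Basis \<Longrightarrow> l \<bullet> b \<le> u \<bullet> b"
  then have lu': "l $ a \<le> u $ a" for a by (metis axis_in_Basis_iff cart_eq_inner_axis Basis_real_def singletonI)
  let ?l = "(\<chi> j. l $ ?\<sigma> j) :: real^'n" and ?u = "(\<chi> j. u $ ?\<sigma> j) :: real^'n"
  have vimage: "?f -` box l u = box ?l ?u"
    by (auto simp: mem_box_cart \<sigma>) (metis \<sigma>)+
  have prod_Basis: "(\<Prod>b\<in>Basis. (v - w) \<bullet> b) = (\<Prod>a\<in>UNIV. v $ a - w $ a)" for v w :: "real^'k::finite"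
  proof -
    have Basis: "(Basis :: (real^'k) set) = range (\<lambda>a. axis a 1)" by (auto simp: Basis_vec_def)
    show ?thesis unfolding Basis
      by (subst prod.reindex) (auto simp: inj_on_def axis_eq_axis cart_eq_inner_axis[symmetric] inner_diff_left)
  qed
  have "emeasure (distr lborel borel ?f) (box l u) = emeasure lborel (box ?l ?u)"
    by (subst emeasure_distr) (auto simp: vimage)
  also have "\<dots> = ennreal (\<Prod>b\<in>Basis. (?u - ?l) \<bullet> b)"
    by (rule emeasure_lborel_box) (auto simp: Basis_vec_def inner_axis lu')
  also have "(\<Prod>b\<in>Basis. (?u - ?l) \<bullet> b) = (\<Prod>j\<in>UNIV. u $ ?\<sigma> j - l $ ?\<sigma> j)"
    by (simp add: prod_Basis)
  also have "\<dots> = (\<Prod>b\<in>Basis. (u - l) \<bullet> b)"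
    unfolding prod_Basis by (rule prod.reindex_bij_betw) (use assms in \<open>simp add: bij_imp_bij_inv\<close>)
  finally show "emeasure (distr lborel borel ?f) (box l u) = (\<Prod>b\<in>Basis. (u - l) \<bullet> b)" .
qed simp

text \<open>\<open>has_measure_differentiable_image\<close> is an equivalence between finite
  quantities. Read in one direction it gives the value when the image has finite measure; read in
  the other it shows that a finite Jacobian integral would force the image to have finite measure,
  which settles the infinite case.\<close>

lemma emeasure_differentiable_image_wellorder:
  fixes h :: "real^'m::{finite,wellorder} \<Rightarrow> real^'m::_"
  assumes E: "E \<in> sets borel" "h ` E \<in> sets borel"
    and der: "\<And>u. u \<in> E \<Longrightarrow> (h has_derivative h' u) (at u)"
    and inj: "inj_on h E"
    and meas: "(\<lambda>u. \<bar>det (matrix (h' u))\<bar> * indicator E u) \<in> borel_measurable borel"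
  shows "emeasure lborel (h ` E) = (\<integral>\<^sup>+u\<in>E. ennreal \<bar>det (matrix (h' u))\<bar> \<partial>lborel)"
proof -
  define D where "D u = \<bar>det (matrix (h' u))\<bar> * indicator E u" for u
  have D: "D \<in> borel_measurable borel" "\<And>u. 0 \<le> D u"
    using meas by (auto simp: D_def[abs_def])
  have nn: "(\<integral>\<^sup>+u\<in>E. ennreal \<bar>det (matrix (h' u))\<bar> \<partial>lborel) = (\<integral>\<^sup>+u. D u \<partial>lborel)"
    by (rule nn_integral_cong) (auto simp: D_def indicator_def)
  have D_E: "(D has_integral m) UNIV \<longleftrightarrow> ((\<lambda>u. \<bar>det (matrix (h' u))\<bar>) has_integral m) E" for m
    unfolding has_integral_restrict_UNIV[of E, symmetric] D_def
    by (rule has_integral_cong) (auto simp: indicator_def)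
  have image: "h ` E \<in> lmeasurable \<and> measure lebesgue (h ` E) = m \<longleftrightarrow> (D has_integral m) UNIV" for m
    unfolding D_E by (rule has_measure_differentiable_image)
      (use E der inj in \<open>auto intro: has_derivative_at_withinI\<close>)
  have em: "emeasure lborel (h ` E) = emeasure lebesgue (h ` E)" using E by simp
  show ?thesis
  proof (cases "emeasure lborel (h ` E) < \<infinity>")
    case True
    have lm: "h ` E \<in> lmeasurable"
      by (rule fmeasurableI[OF _ True[unfolded em]]) (use E in simp)
    then have "(D has_integral measure lebesgue (h ` E)) UNIV" using image by blast
    from nn_integral_has_integral_lborel[OF D this] show ?thesis
      unfolding nn em by (simp only: emeasure_eq_measure2[OF lm])
  next
    case False
    have "(\<integral>\<^sup>+u. D u \<partial>lborel) = \<infinity>"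
    proof (rule ccontr)
      assume "(\<integral>\<^sup>+u. D u \<partial>lborel) \<noteq> \<infinity>"
      then have "integrable lborel D"
        using D by (intro integrableI_nonneg) (auto simp: top.not_eq_extremum)
      from has_integral_integral_lborel[OF this] image have "h ` E \<in> lmeasurable" by blast
      then show False using False unfolding em fmeasurable_def by blast
    qed
    with False show ?thesis by (simp add: nn not_less top_unique)
  qed
qed

text \<open>Conjugate \<open>h\<close> by the relabelling \<open>\<rho>\<close>: images keep their
  measure and the Jacobian determinant keeps its value.\<close>

lemma emeasure_differentiable_image:
  fixes h :: "real^'n::finite \<Rightarrow> real^'n"
  assumes E: "E \<in> sets borel" "h ` E \<in> sets borel"
    and der: "\<And>u. u \<in> E \<Longrightarrow> (h has_derivative h' u) (at u)"
    and inj: "inj_on h E"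
    and meas: "(\<lambda>u. \<bar>det (matrix (h' u))\<bar> * indicator E u) \<in> borel_measurable borel"
  shows "emeasure lborel (h ` E) = (\<integral>\<^sup>+u\<in>E. ennreal \<bar>det (matrix (h' u))\<bar> \<partial>lborel)"
proof -
  let ?\<pi> = "Rep_enumerated :: 'n enumerated \<Rightarrow> 'n"
  define \<rho> where "\<rho> x = (\<chi> a. x $ ?\<pi> a)" for x :: "real^'n"
  define \<sigma> where "\<sigma> y = (\<chi> j. y $ Abs_enumerated j)" for y :: "real^'n enumerated"
  have inv [simp]: "\<sigma> (\<rho> x) = x" "\<rho> (\<sigma> y) = y" for x y
    by (auto simp: \<rho>_def \<sigma>_def vec_eq_iff Abs_enumerated_inverse Rep_enumerated_inverse)
  have lin: "linear \<rho>" "linear \<sigma>" by (auto simp: \<rho>_def \<sigma>_def vec_eq_iff intro!: linearI)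
  then have cont: "continuous_on UNIV \<rho>" "continuous_on UNIV \<sigma>"
    by (auto intro: linear_continuous_on linear_conv_bounded_linear[THEN iffD1])
  then have [measurable]: "\<rho> \<in> borel_measurable borel" "\<sigma> \<in> borel_measurable borel"
    by (auto intro: borel_measurable_continuous_onI)
  have distr: "distr lborel borel \<rho> = lborel"
    using lborel_vec_reindex[OF bij_Rep_enumerated] unfolding \<rho>_def[abs_def] .
  have image: "\<rho> ` A = \<sigma> -` A" for A by (auto simp: image_iff) (metis inv(2))
  have sets: "\<rho> ` A \<in> sets borel" if "A \<in> sets borel" for A
    using measurable_sets[of \<sigma> borel borel A] that unfolding image by simp
  have emeasure: "emeasure lborel (\<rho> ` A) = emeasure lborel A" if "A \<in> sets borel" for A
  proof -
    have "\<rho> -` \<rho> ` A = A" by (metis inj_vimage_image_eq inj_on_inverseI inv(1))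
    then show ?thesis
      using emeasure_distr[of \<rho> lborel borel "\<rho> ` A"] sets[OF that] by (simp add: distr)
  qed
  let ?h = "\<lambda>y. \<rho> (h (\<sigma> y))" and ?h' = "\<lambda>y v. \<rho> (h' (\<sigma> y) (\<sigma> v))"
  have det: "det (matrix (?h' y)) = det (matrix (h' (\<sigma> y)))" for y
  proof -
    have \<sigma>_axis: "\<sigma> (axis b 1) = axis (?\<pi> b) 1" for b
      unfolding vec_eq_iff by (auto simp: \<sigma>_def axis_def Abs_enumerated_inverse Rep_enumerated_inverse)
    have "matrix (?h' y) = (\<chi> a b. matrix (h' (\<sigma> y)) $ ?\<pi> a $ ?\<pi> b)"
      by (simp add: matrix_def \<rho>_def \<sigma>_axis)
    then show ?thesis by (simp add: det_reindex[OF bij_Rep_enumerated])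
  qed
  have ind: "indicator (\<rho> ` E) y = indicator E (\<sigma> y)" for y
    unfolding image by (simp add: indicator_def)
  have eq: "?h ` \<rho> ` E = \<rho> ` h ` E" by (simp add: image_image)
  have "emeasure lborel (h ` E) = emeasure lborel (?h ` \<rho> ` E)"
    unfolding eq by (rule emeasure[symmetric]) fact
  also have "\<dots> = (\<integral>\<^sup>+y\<in>\<rho> ` E. ennreal \<bar>det (matrix (?h' y))\<bar> \<partial>lborel)"
  proof (rule emeasure_differentiable_image_wellorder)
    show "?h ` \<rho> ` E \<in> sets borel" unfolding eq by (intro sets E)
    show "(?h has_derivative ?h' y) (at y)" if "y \<in> \<rho> ` E" for y
    proof -
      from that have "(h has_derivative h' (\<sigma> y)) (at (\<sigma> y))" by (auto intro: der)
      from has_derivative_compose[OF linear_imp_has_derivative[OF lin(2)] this]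
      show ?thesis by (rule has_derivative_compose[OF _ linear_imp_has_derivative[OF lin(1)]])
    qed
    show "inj_on ?h (\<rho> ` E)"
      by (rule inj_onI) (metis inj inj_onD inv(1) imageE)
    have "(\<lambda>y. (\<lambda>u. \<bar>det (matrix (h' u))\<bar> * indicator E u) (\<sigma> y)) \<in> borel_measurable borel"
      by (rule measurable_compose[OF _ meas]) measurable
    then show "(\<lambda>y. \<bar>det (matrix (?h' y))\<bar> * indicator (\<rho> ` E) y) \<in> borel_measurable borel"
      unfolding det ind .
  qed (intro sets E)
  also have "\<dots> = (\<integral>\<^sup>+y. ennreal (\<bar>det (matrix (h' (\<sigma> y)))\<bar> * indicator E (\<sigma> y)) \<partial>distr lborel borel \<rho>)"
    unfolding distr by (rule nn_integral_cong) (auto simp: det image indicator_def)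
  also have "\<dots> = (\<integral>\<^sup>+x. ennreal (\<bar>det (matrix (h' x))\<bar> * indicator E x) \<partial>lborel)"
  proof (subst nn_integral_distr)
    have "(\<lambda>y. (\<lambda>u. \<bar>det (matrix (h' u))\<bar> * indicator E u) (\<sigma> y)) \<in> borel_measurable borel"
      by (rule measurable_compose[OF _ meas]) measurable
    then show "(\<lambda>y. ennreal (\<bar>det (matrix (h' (\<sigma> y)))\<bar> * indicator E (\<sigma> y))) \<in> borel_measurable (distr lborel borel \<rho>)"
      by (simp add: distr)
  qed simp_all
  also have "\<dots> = (\<integral>\<^sup>+u\<in>E. ennreal \<bar>det (matrix (h' u))\<bar> \<partial>lborel)"
    by (rule nn_integral_cong) (auto simp: indicator_def)
  finally show ?thesis .
qed

lemma nn_integral_differentiable_image: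
  fixes h :: "real^'n::finite \<Rightarrow> real^'n"
  assumes E: "E \<in> sets borel" and cont: "continuous_on E h"
    and image: "\<And>E'. E' \<in> sets borel \<Longrightarrow> E' \<subseteq> E \<Longrightarrow> h ` E' \<in> sets borel"
    and der: "\<And>u. u \<in> E \<Longrightarrow> (h has_derivative h' u) (at u)"
    and inj: "inj_on h E"
    and cont': "continuous_on E (\<lambda>u. det (matrix (h' u)))"
    and w [measurable]: "w \<in> borel_measurable borel"
  shows "(\<integral>\<^sup>+x\<in>h ` E. w x \<partial>lborel) = (\<integral>\<^sup>+u\<in>E. w (h u) * ennreal \<bar>det (matrix (h' u))\<bar> \<partial>lborel)"
proof -
  define D where "D u = ennreal \<bar>det (matrix (h' u))\<bar>" for u
  have restr: "sets (restrict_space lborel E) = sets (restrict_space borel E)"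
    by (intro sets_restrict_space_cong) simp
  have [measurable]: "h \<in> borel_measurable (restrict_space lborel E)"
    using borel_measurable_continuous_on_restrict[OF cont] measurable_cong_sets[OF restr refl] by blast
  have "(\<lambda>u. det (matrix (h' u))) \<in> borel_measurable (restrict_space lborel E)"
    using borel_measurable_continuous_on_restrict[OF cont'] measurable_cong_sets[OF restr refl] by blast
  then have [measurable]: "D \<in> borel_measurable (restrict_space lborel E)"
    unfolding D_def[abs_def] by measurable
  have E' [simp]: "E \<in> sets lborel" "E \<inter> space lborel \<in> sets lborel" "h ` E \<in> sets borel"
    using E image[OF E] by auto
  have ind [simp]: "(indicator (h ` E) :: _ \<Rightarrow> ennreal) \<in> borel_measurable borel"
    by (rule borel_measurable_indicator) simp
  note restrict = nn_integral_restrict_space[OF E'(2)]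
  have eq: "distr (density (restrict_space lborel E) D) borel h = density lborel (indicator (h ` E))"
  proof (rule measure_eqI)
    fix B assume "B \<in> sets (distr (density (restrict_space lborel E) D) borel h)"
    then have B [measurable]: "B \<in> sets borel" by simp
    define E1 where "E1 = E \<inter> h -` B"
    have E1: "E1 \<in> sets borel" "E1 \<subseteq> E"
    proof -
      have "h -` B \<inter> space (restrict_space lborel E) \<in> sets (restrict_space lborel E)" by measurable
      then show "E1 \<in> sets borel"
        using E by (simp add: E1_def space_restrict_space sets_restrict_space_iff Int_commute)
    qed (simp add: E1_def)
    have "emeasure (distr (density (restrict_space lborel E) D) borel h) B =
        (\<integral>\<^sup>+u. D u * indicator (h -` B \<inter> E) u \<partial>restrict_space lborel E)"
      by (subst emeasure_distr, simp_all, subst emeasure_density, simp_all add: space_restrict_space)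
        (use E1 E in \<open>auto simp: sets_restrict_space_iff E1_def Int_commute\<close>)
    also have "\<dots> = (\<integral>\<^sup>+u\<in>E1. D u \<partial>lborel)"
      unfolding restrict by (rule nn_integral_cong) (auto simp: E1_def indicator_def)
    also have "\<dots> = emeasure lborel (h ` E1)"
      unfolding D_def
    proof (rule emeasure_differentiable_image[symmetric])
      have "(\<lambda>u. indicator E1 u *\<^sub>R \<bar>det (matrix (h' u))\<bar>) \<in> borel_measurable borel"
        by (intro borel_measurable_continuous_on_indicator E1 continuous_intros
            continuous_on_subset[OF cont'])
      then show "(\<lambda>u. \<bar>det (matrix (h' u))\<bar> * indicator E1 u) \<in> borel_measurable borel"
        by (simp add: mult.commute)
    qed (use E1 image der inj in \<open>auto intro: inj_on_subset\<close>)
    also have "h ` E1 = h ` E \<inter> B" by (auto simp: E1_def)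
    also have "emeasure lborel (h ` E \<inter> B) = emeasure (density lborel (indicator (h ` E))) B"
      by (subst emeasure_density) (simp_all add: indicator_inter_arith[symmetric] sets.Int[OF E'(3) B])
    finally show "emeasure (distr (density (restrict_space lborel E) D) borel h) B =
        emeasure (density lborel (indicator (h ` E))) B" .
  qed simp
  have "(\<integral>\<^sup>+x\<in>h ` E. w x \<partial>lborel) = (\<integral>\<^sup>+x. w x \<partial>density lborel (indicator (h ` E)))"
    by (subst nn_integral_density) (auto simp: mult.commute)
  also have "\<dots> = (\<integral>\<^sup>+u. w (h u) \<partial>density (restrict_space lborel E) D)"
    unfolding eq[symmetric] by (subst nn_integral_distr) auto
  also have "\<dots> = (\<integral>\<^sup>+u. D u * w (h u) \<partial>restrict_space lborel E)"
    by (subst nn_integral_density) auto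
  also have "\<dots> = (\<integral>\<^sup>+u\<in>E. w (h u) * D u \<partial>lborel)"
    unfolding restrict by (simp add: mult.commute)
  finally show ?thesis unfolding D_def .
qed

section \<open>Directional derivatives of compactly supported functions\<close>

text \<open>Difference quotients of a translate integrate to zero; this passes to the limit.\<close>

lemma integral_directional_derivative_eq_0:
  fixes W :: "'a::euclidean_space \<Rightarrow> real" and v :: 'a
  assumes der: "\<And>x. (W has_derivative W' x) (at x)"
    and cont: "continuous_on UNIV (\<lambda>x. W' x v)"
    and K: "compact K" "\<And>x. x \<notin> K \<Longrightarrow> W x = 0"
  shows "integrable lborel (\<lambda>x. W' x v)" "(\<integral>x. W' x v \<partial>lborel) = 0"
proof -
  have contW: "continuous_on UNIV W"
    using der by (auto intro!: continuous_at_imp_continuous_on has_derivative_continuous)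
  have [measurable]: "W \<in> borel_measurable borel" "(\<lambda>x. W' x v) \<in> borel_measurable borel"
    by (auto intro: borel_measurable_continuous_onI contW cont)
  \<comment> \<open>\<open>K\<close> swept back along \<open>v\<close> for times in [0,1]. As the
    steps are at most 1, all the difference quotients below vanish outside this one compact
    set.\<close>
  define K1 where "K1 = {x + y | x y. x \<in> K \<and> y \<in> (\<lambda>s. s *\<^sub>R (- v)) ` {0..1}}"
  have K1: "compact K1" unfolding K1_def
    by (rule compact_sums[OF K(1)]) (auto intro!: compact_continuous_image continuous_intros)
  have W'0: "W' x v = 0" if "x \<notin> K" for x
  proof -
    have "open (- K)" using K(1) compact_imp_closed by auto
    then have "(W has_derivative (\<lambda>_. 0)) (at x)"
      using that K(2) by (intro has_derivative_transform_within_open[OF has_derivative_const[of 0] \<open>open (- K)\<close>]) auto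
    with der[of x] have "W' x = (\<lambda>_. 0)" by (rule has_derivative_unique)
    then show ?thesis by simp
  qed
  have "bounded ((\<lambda>x. W' x v) ` K)"
    by (intro compact_imp_bounded compact_continuous_image K(1) continuous_on_subset[OF cont]) auto
  then obtain C where C: "C > 0" "\<And>x. x \<in> K \<Longrightarrow> \<bar>W' x v\<bar> \<le> C"
    by (auto simp: bounded_pos)
  have C': "\<bar>W' x v\<bar> \<le> C" for x
    using C W'0[of x] by (cases "x \<in> K") auto
  have fin: "emeasure lborel X < \<infinity>" if "compact X" for X :: "'a set"
    by (rule emeasure_bounded_finite) (use that compact_imp_bounded in blast)
  have int_ind: "integrable lborel (\<lambda>x. C * indicator K1 x :: real)"
    using fin[OF K1] K1 by (intro integrable_mult_right integrable_real_indicator)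
      (auto simp: compact_imp_closed)
  define d where "d n x = (W (x + (1 / real (Suc n)) *\<^sub>R v) - W x) / (1 / real (Suc n))" for n x
  have int_W: "integrable lborel W"
  proof -
    have "bounded (W ` K)"
      by (intro compact_imp_bounded compact_continuous_image K(1) continuous_on_subset[OF contW]) auto
    then obtain B where B: "B > 0" "\<And>x. x \<in> K \<Longrightarrow> \<bar>W x\<bar> \<le> B" by (auto simp: bounded_pos)
    have "integrable lborel (\<lambda>x. B * indicator K x :: real)"
      using fin[OF K(1)] K(1) by (intro integrable_mult_right integrable_real_indicator)
        (auto simp: compact_imp_closed)
    then show ?thesis
      by (rule Bochner_Integration.integrable_bound) (use B K(2) in \<open>auto simp: indicator_def\<close>)
  qed
  have int_d: "(\<integral>x. d n x \<partial>lborel) = 0" for n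
  proof -
    have shift: "integrable lborel (\<lambda>x. W (w + x))" "(\<integral>x. W (w + x) \<partial>lborel) = (\<integral>x. W x \<partial>lborel)" for w
      using int_W integrable_distr_eq[of "(+) w" lborel borel W]
        integral_distr[of "(+) w" lborel borel W] by (auto simp: lborel_distr_plus)
    show ?thesis
      unfolding d_def using int_W shift[of "(1 / real (Suc n)) *\<^sub>R v"]
      by (simp add: add.commute[of _ "_ *\<^sub>R v"])
  qed
  have lim: "(\<lambda>n. d n x) \<longlonglongrightarrow> W' x v" for x
  proof -
    have d: "((\<lambda>t. W (x + t *\<^sub>R v)) has_derivative (\<lambda>t. W' x (t *\<^sub>R v))) (at 0)"
      by (rule has_derivative_compose[where g = W and f = "\<lambda>t. x + t *\<^sub>R v"])
        (auto intro!: derivative_eq_intros simp: der)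
    have "W' x (t *\<^sub>R v) = t * W' x v" for t
      using der[of x] has_derivative_linear linear_cmul by fastforce
    then have "((\<lambda>t. W (x + t *\<^sub>R v)) has_real_derivative W' x v) (at 0)"
      unfolding has_field_derivative_def
      by (intro has_derivative_eq_rhs[OF d]) (simp add: fun_eq_iff)
    then have lim0: "((\<lambda>t. (W (x + t *\<^sub>R v) - W x) / t) \<longlongrightarrow> W' x v) (at 0)"
      by (simp add: DERIV_def)
    have "filterlim (\<lambda>n. 1 / real (Suc n)) (at 0) sequentially"
      using LIMSEQ_inverse_real_of_nat by (simp add: filterlim_at inverse_eq_divide)
    from filterlim_compose[OF lim0 this] show ?thesis unfolding d_def .
  qed
  have bound: "\<bar>d n x\<bar> \<le> C * indicator K1 x" for n x
  proof (cases "x \<in> K1")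
    case True
    let ?t = "1 / real (Suc n)"
    have "\<bar>W (x + ?t *\<^sub>R v) - W x\<bar> \<le> C * ?t"
    proof -
      have der1: "((\<lambda>t. W (x + t *\<^sub>R v)) has_derivative (\<lambda>s. W' (x + t *\<^sub>R v) (s *\<^sub>R v))) (at t)" for t
        by (rule has_derivative_compose[where g = W and f = "\<lambda>t. x + t *\<^sub>R v"])
          (auto intro!: derivative_eq_intros simp: der)
      have lin: "W' y (t *\<^sub>R v) = t * W' y v" for y t
        using der[of y] has_derivative_linear linear_cmul by fastforce
      \<comment> \<open>The mean value theorem turns the supremum of the derivative into a bound on
        the difference quotients that is uniform in \<open>n\<close>, as dominated convergence
        demands.\<close>
      have "\<exists>z\<in>{0<..<?t}. W (x + ?t *\<^sub>R v) - W (x + 0 *\<^sub>R v) = W' (x + z *\<^sub>R v) ((?t - 0) *\<^sub>R v)"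
        by (rule mvt_simple) (auto intro: has_derivative_at_withinI der1)
      then obtain z where "W (x + ?t *\<^sub>R v) - W x = ?t * W' (x + z *\<^sub>R v) v"
        by (auto simp: lin)
      then have "\<bar>W (x + ?t *\<^sub>R v) - W x\<bar> = \<bar>W' (x + z *\<^sub>R v) v\<bar> * ?t"
        by (simp add: abs_mult)
      also have "\<dots> \<le> C * ?t" by (intro mult_right_mono C') simp
      finally show ?thesis .
    qed
    then show ?thesis using True by (simp add: d_def abs_mult pos_le_divide_eq)
  next
    case False
    then have "x \<notin> K"  and "x + (1 / real (Suc n)) *\<^sub>R v \<notin> K"
    proof -
      show "x \<notin> K"
      proof
        assume "x \<in> K"
        then have "x = x + 0 *\<^sub>R (- v) \<and> x \<in> K \<and> 0 *\<^sub>R (- v) \<in> (\<lambda>s. s *\<^sub>R (- v)) ` {0..1}" by force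
        then show False using False unfolding K1_def by blast
      qed
      show "x + (1 / real (Suc n)) *\<^sub>R v \<notin> K"
      proof
        assume "x + (1 / real (Suc n)) *\<^sub>R v \<in> K"
        moreover have "(1 / real (Suc n)) *\<^sub>R (- v) \<in> (\<lambda>s. s *\<^sub>R (- v)) ` {0..1}"
          by (intro imageI) (auto simp: divide_simps)
        moreover have "x = (x + (1 / real (Suc n)) *\<^sub>R v) + (1 / real (Suc n)) *\<^sub>R (- v)" by simp
        ultimately show False using False unfolding K1_def by blast
      qed
    qed
    then show ?thesis using False K(2) by (simp add: d_def)
  qed
  have meas: "(\<lambda>x. d n x) \<in> borel_measurable lborel" for n
    unfolding d_def by measurable
  show "integrable lborel (\<lambda>x. W' x v)"
    by (rule integrable_dominated_convergence[where s = d and w = "\<lambda>x. C * indicator K1 x"])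
      (use meas int_ind lim bound in auto)
  have "(\<lambda>n. \<integral>x. d n x \<partial>lborel) \<longlonglongrightarrow> (\<integral>x. W' x v \<partial>lborel)"
    by (rule integral_dominated_convergence[where w = "\<lambda>x. C * indicator K1 x"])
      (use meas int_ind lim bound in auto)
  then show "(\<integral>x. W' x v \<partial>lborel) = 0"
    unfolding int_d using LIMSEQ_unique tendsto_const by blast
qed

section \<open>Geometry of the grim reaper hyperplane\<close>

text \<open>Along any admissible curve, \<open>F\<close> agrees with the ambient extension
  \<open>g\<close> for small times, so the chain rule yields the same value for all curves with
  velocity \<open>v\<close>.\<close>

lemma surface_deriv_eq:
  assumes "open U" "p \<in> U" and eq: "\<And>q. q \<in> U \<inter> \<Sigma> \<Longrightarrow> F q = g q"
    and der: "(g has_derivative g') (at p)" and v: "v \<in> tangent_space \<Sigma> p"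
  shows "surface_deriv \<Sigma> F p v = g' v"
proof -
  have *: "((F \<circ> c) has_vector_derivative g' v) (at 0)" if "curve_in \<Sigma> p v c" for c
  proof -
    from that obtain e where c: "c 0 = p" "(c has_vector_derivative v) (at 0)"
      and e: "e > 0" "c ` {-e<..<e} \<subseteq> \<Sigma>" "smooth_on {-e<..<e} c"
      unfolding curve_in_def by blast
    have 1: "open ({-e<..<e} \<inter> c -` U)"
      by (rule continuous_open_preimage[OF smooth_onD_continuous[OF e(3)] open_greaterThanLessThan assms(1)])
    have 2: "0 \<in> {-e<..<e} \<inter> c -` U" using c assms(2) e by simp
    have "((g \<circ> c) has_vector_derivative g' v) (at 0)"
    proof -
      have "((g \<circ> c) has_derivative (g' \<circ> (\<lambda>t. t *\<^sub>R v))) (at 0)"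
        by (rule diff_chain_at) (use c der in \<open>simp_all add: has_vector_derivative_def\<close>)
      then show ?thesis
        using linear_cmul[OF has_derivative_linear[OF der]] by (simp add: has_vector_derivative_def comp_def)
    qed
    then show ?thesis
      by (rule has_vector_derivative_transform_within_open[OF _ 1 2])
        (use e(2) eq in \<open>auto simp: image_subset_iff\<close>)
  qed
  \<comment> \<open>Tangency of \<open>v\<close> supplies a curve. Without one the condition in
    \<open>surface_deriv\<close> would be vacuous and would not single out a value.\<close>
  obtain c where c: "curve_in \<Sigma> p v c" using v unfolding tangent_space_def by blast
  show ?thesis
    unfolding surface_deriv_def
  proof (rule the_equality)
    show "w = g' v" if "\<forall>c. curve_in \<Sigma> p v c \<longrightarrow> ((F \<circ> c) has_vector_derivative w) (at 0)" for w
      using that c *[OF c] vector_derivative_unique_at by blast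
  qed (use * in blast)
qed

section \<open>The graph parametrization and its tangent spaces\<close>

definition slab :: "'n::finite \<Rightarrow> (real^'n) set" where
  "slab i = {x. - pi / 2 < x $ i \<and> x $ i < pi / 2}"

definition grim_graph :: "'n::finite \<Rightarrow> real^'n \<Rightarrow> (real^'n) \<times> real" where
  "grim_graph i x = (x, - ln (cos (x $ i)))"

lemma fst_grim_graph [simp]: "fst (grim_graph i x) = x"
  by (simp add: grim_graph_def)

lemma grim_reaper_hyperplane_eq: "grim_reaper_hyperplane i = grim_graph i ` slab i"
  by (auto simp: grim_reaper_hyperplane_def grim_reaper_curve_def grim_graph_def slab_def)

lemma grim_graph_in [simp]: "grim_graph i x \<in> grim_reaper_hyperplane i \<longleftrightarrow> x \<in> slab i"
  by (auto simp: grim_reaper_hyperplane_eq grim_graph_def)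

lemma in_grim_reaperD:
  "p \<in> grim_reaper_hyperplane i \<Longrightarrow> p = grim_graph i (fst p) \<and> fst p \<in> slab i"
  by (auto simp: grim_reaper_hyperplane_eq)

lemma open_slab: "open (slab i)"
  unfolding slab_def by (intro open_Collect_conj open_Collect_less continuous_intros)

lemma cos_slab_pos: "x \<in> slab i \<Longrightarrow> 0 < cos (x $ i)"
  by (auto simp: slab_def intro: cos_gt_zero_pi)

lemma bounded_linear_component: "bounded_linear (\<lambda>x :: real^'n. x $ i)"
  by (rule bounded_linear_vec_nth)

lemma grim_graph_has_derivative:
  fixes i :: "'n::finite"
  assumes "x \<in> slab i"
  shows "(grim_graph i has_derivative (\<lambda>v. (v, tan (x $ i) * v $ i))) (at x)"
proof -
  have c: "((\<lambda>x::real^'n. x $ i) has_derivative (\<lambda>v. v $ i)) (at x)"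
    by (rule bounded_linear_imp_has_derivative[OF bounded_linear_component])
  have "((\<lambda>t. - ln (cos t)) has_real_derivative tan (x $ i)) (at (x $ i))"
    using cos_slab_pos[OF assms] by (auto intro!: derivative_eq_intros simp: tan_def field_simps)
  then have "((\<lambda>t. - ln (cos t)) has_derivative (\<lambda>h. tan (x $ i) * h)) (at (x $ i))"
    by (simp add: has_field_derivative_def)
  from has_derivative_compose[OF c this] show ?thesis
    unfolding grim_graph_def[abs_def] by (intro has_derivative_Pair has_derivative_ident)
qed

lemma smooth_on_component: "open U \<Longrightarrow> smooth_on U (\<lambda>x :: real^'n::finite. x $ i)"
  by (rule smooth_on_bounded_linear[OF bounded_linear_component])

lemma smooth_on_grim_graph: "smooth_on (slab i) (grim_graph i)"
proof -
  have "smooth_on (slab i) (\<lambda>x. cos (x $ i))"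
    by (rule smooth_on_compose[OF open_slab open_UNIV _ smooth_on_cos smooth_on_component[OF open_slab]]) simp
  then have ln: "smooth_on (slab i) (\<lambda>x. ln (cos (x $ i)))"
    using smooth_on_compose[OF open_slab open_greaterThan _ smooth_on_ln, of "\<lambda>x. cos (x $ i)"]
    by (auto intro: cos_slab_pos)
  have "smooth_on (slab i) (\<lambda>x. (x, 0) + ln (cos (x $ i)) *\<^sub>R (0, -1 :: real))"
    by (intro smooth_on_add[OF open_slab] smooth_on_scaleR[OF open_slab ln] smooth_on_const
        smooth_on_bounded_linear[OF _ open_slab] bounded_linear_Pair bounded_linear_ident bounded_linear_zero)
  then show ?thesis by (simp add: grim_graph_def[abs_def])
qed

text \<open>The differential of \<open>grim_graph i\<close> at \<open>x\<close>: the slope of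
  \<open>- ln (cos t)\<close> is \<open>tan t\<close>.\<close>

definition grim_lift :: "'n::finite \<Rightarrow> real^'n \<Rightarrow> real^'n \<Rightarrow> (real^'n) \<times> real" where
  "grim_lift i x v = (v, tan (x $ i) * v $ i)"

text \<open>The open set \<open>W\<close> is present because the normals in
  \<open>second_ff_norm_sq\<close> live only on a piece of the hypersurface. A curve in the
  hypersurface is the lift of its horizontal projection, hence so is its velocity; conversely,
  lifting a short straight segment realises every direction.\<close>

lemma tangent_space_grim_reaper:
  assumes "open W" "x \<in> slab i" "grim_graph i x \<in> W"
  shows "tangent_space (grim_reaper_hyperplane i \<inter> W) (grim_graph i x) = range (grim_lift i x)"
proof (intro equalityI subsetI)
  fix v assume "v \<in> tangent_space (grim_reaper_hyperplane i \<inter> W) (grim_graph i x)"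
  then obtain c e where c: "c 0 = grim_graph i x" "(c has_vector_derivative v) (at 0)"
    and e: "e > 0" "c ` {-e<..<e} \<subseteq> grim_reaper_hyperplane i \<inter> W"
    unfolding tangent_space_def curve_in_def by blast
  have "((\<lambda>t. fst (c t)) has_vector_derivative fst v) (at 0)"
    using c(2) by (rule bounded_linear.has_vector_derivative[OF bounded_linear_fst])
  then have "((grim_graph i \<circ> (\<lambda>t. fst (c t))) has_derivative
      ((\<lambda>v. (v, tan (x $ i) * v $ i)) \<circ> (\<lambda>t. t *\<^sub>R fst v))) (at 0)"
    by (intro diff_chain_at) (use c(1) grim_graph_has_derivative[OF assms(2)] in
        \<open>simp_all add: has_vector_derivative_def\<close>)
  then have "((grim_graph i \<circ> (\<lambda>t. fst (c t))) has_vector_derivative grim_lift i x (fst v)) (at 0)"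
    by (simp add: has_vector_derivative_def comp_def grim_lift_def mult.left_commute)
  moreover have "grim_graph i (fst (c t)) = c t" if "t \<in> {-e<..<e}" for t
    using in_grim_reaperD[of "c t" i] e(2) that by (simp add: image_subset_iff)
  ultimately have "(c has_vector_derivative grim_lift i x (fst v)) (at 0)"
    using has_vector_derivative_transform_within_open[of "grim_graph i \<circ> (\<lambda>t. fst (c t))" _ 0 "{-e<..<e}" c] e(1)
    by simp
  from vector_derivative_unique_at[OF c(2) this] show "v \<in> range (grim_lift i x)" by blast
next
  fix w assume "w \<in> range (grim_lift i x)"
  then obtain v where w: "w = grim_lift i x v" by blast
  let ?V = "slab i \<inter> grim_graph i -` W"
  have V: "open ?V" 
    by (rule continuous_open_preimage[OF smooth_onD_continuous[OF smooth_on_grim_graph] open_slab assms(1)])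
  have "open ((\<lambda>t. x + t *\<^sub>R v) -` ?V)"
    by (rule open_vimage[OF V]) (intro continuous_intros)
  moreover have "(0::real) \<in> (\<lambda>t. x + t *\<^sub>R v) -` ?V" using assms by simp
  ultimately obtain e where e: "e > 0" "ball 0 e \<subseteq> (\<lambda>t. x + t *\<^sub>R v) -` ?V"
    by (meson open_contains_ball)
  have ball: "ball 0 e = {-e<..<e}" by (auto simp: dist_real_def)
  let ?c = "\<lambda>t. grim_graph i (x + t *\<^sub>R v)"
  have "smooth_on {-e<..<e} ?c"
  proof (rule smooth_on_compose[OF _ open_slab _ smooth_on_grim_graph])
    show "smooth_on {-e<..<e} (\<lambda>t. x + t *\<^sub>R v)"
      by (intro smooth_on_add smooth_on_const smooth_on_bounded_linear bounded_linear_scaleR_left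
          open_greaterThanLessThan)
  qed (use e ball in auto)
  moreover have "?c ` {-e<..<e} \<subseteq> grim_reaper_hyperplane i \<inter> W" using e(2) unfolding ball by auto
  moreover have "(?c has_vector_derivative w) (at 0)"
  proof -
    have "((\<lambda>t. x + t *\<^sub>R v) has_derivative (\<lambda>t. t *\<^sub>R v)) (at 0)"
      by (auto intro!: derivative_eq_intros)
    from has_derivative_compose[OF this, of "grim_graph i", simplified, OF grim_graph_has_derivative[OF assms(2)]]
    show ?thesis by (simp add: has_vector_derivative_def w grim_lift_def mult.left_commute)
  qed
  ultimately have "curve_in (grim_reaper_hyperplane i \<inter> W) (grim_graph i x) w ?c"
    unfolding curve_in_def using e(1) by auto
  then show "w \<in> tangent_space (grim_reaper_hyperplane i \<inter> W) (grim_graph i x)"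
    unfolding tangent_space_def by blast
qed

lemma tangent_space_grim_reaper':
  "x \<in> slab i \<Longrightarrow> tangent_space (grim_reaper_hyperplane i) (grim_graph i x) = range (grim_lift i x)"
  using tangent_space_grim_reaper[OF open_UNIV] by simp

lemma linear_grim_lift: "linear (grim_lift i x)"
  by (rule linearI) (auto simp: grim_lift_def algebra_simps)

lemma subspace_range_grim_lift: "subspace (range (grim_lift i x))"
  by (rule linear_subspace_image[OF linear_grim_lift subspace_UNIV])

lemma smooth_on_pullback:
  assumes "smooth_map_on (grim_reaper_hyperplane i) f"
  shows "smooth_on (slab i) (\<lambda>x. f (grim_graph i x))"
proof (rule smooth_on_locally)
  fix x assume x: "x \<in> slab i"
  then obtain U g where U: "open U" "grim_graph i x \<in> U" "smooth_on U g"
    and eq: "\<forall>y\<in>U \<inter> grim_reaper_hyperplane i. f y = g y"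
    using assms grim_graph_in unfolding smooth_map_on_def by meson
  let ?V = "slab i \<inter> grim_graph i -` U"
  have V: "open ?V"
    by (rule continuous_open_preimage[OF smooth_onD_continuous[OF smooth_on_grim_graph] open_slab U(1)])
  have "smooth_on ?V (\<lambda>x. g (grim_graph i x))"
    by (rule smooth_on_compose[OF V U(1) _ U(3) smooth_on_subset[OF smooth_on_grim_graph]]) auto
  then have "smooth_on ?V (\<lambda>x. f (grim_graph i x))"
    by (rule smooth_on_cong[OF V, rotated]) (use eq in auto)
  then show "\<exists>V. open V \<and> x \<in> V \<and> smooth_on V (\<lambda>x. f (grim_graph i x))"
    using V x U(2) by blast
qed

text \<open>In the graph chart the metric is the identity plus \<open>tan\<^sup>2 x\<^sub>i\<close>
  in direction \<open>i\<close>, so its inverse scales the \<open>i\<close>-th component by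
  \<open>cos\<^sup>2 x\<^sub>i = 1 - sin\<^sup>2 x\<^sub>i\<close>. The right-hand side is the
  inverse metric evaluated on \<open>d\<close>.\<close>

lemma norm_surface_gradient_grim_reaper:
  fixes d :: "real^'n::finite"
  assumes x: "x \<in> slab i"
    and der: "((\<lambda>x. f (grim_graph i x)) has_derivative (\<lambda>v. d \<bullet> v)) (at x)"
  shows "(norm (surface_gradient (grim_reaper_hyperplane i) f (grim_graph i x)))\<^sup>2 =
    d \<bullet> d - (sin (x $ i))\<^sup>2 * (d $ i)\<^sup>2"
proof -
  let ?p = "grim_graph i x" and ?\<Sigma> = "grim_reaper_hyperplane i"
  let ?T = "range (grim_lift i x)"
  have cos: "cos (x $ i) > 0" by (rule cos_slab_pos[OF x])
  have sd: "surface_deriv ?\<Sigma> f ?p (grim_lift i x v) = d \<bullet> v" for v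
  proof (subst surface_deriv_eq[of "slab i \<times> UNIV" ?p])
    show "open (slab i \<times> (UNIV :: real set))" by (intro open_Times open_slab open_UNIV)
    show "?p \<in> slab i \<times> UNIV" using x by (simp add: grim_graph_def)
    show "f q = f (grim_graph i (fst q))" if "q \<in> slab i \<times> UNIV \<inter> ?\<Sigma>" for q
      using in_grim_reaperD[of q i] that by simp
    show "((\<lambda>q. f (grim_graph i (fst q))) has_derivative (\<lambda>w. d \<bullet> fst w)) (at ?p)"
      by (rule has_derivative_compose[where g = "\<lambda>x. f (grim_graph i x)" and f = fst])
        (use der in \<open>auto intro: derivative_intros\<close>)
    show "grim_lift i x v \<in> tangent_space ?\<Sigma> ?p" by (simp add: tangent_space_grim_reaper'[OF x])
  qed (simp add: grim_lift_def)
  \<comment> \<open>The inverse metric applied to \<open>d\<close>; its lift is the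
    gradient.\<close>
  define b where "b = d - ((sin (x $ i))\<^sup>2 * d $ i) *\<^sub>R axis i 1"
  have bi: "b $ i = (cos (x $ i))\<^sup>2 * d $ i"
    by (simp add: b_def cos_squared_eq algebra_simps)
  have tc: "tan (x $ i) * cos (x $ i) = sin (x $ i)" using cos by (simp add: tan_def)
  have b_inner: "b \<bullet> v = d \<bullet> v - (sin (x $ i))\<^sup>2 * d $ i * v $ i" for v
    by (simp add: b_def inner_diff_left inner_axis' )
  have tb: "tan (x $ i) * b $ i * (tan (x $ i) * t) = (sin (x $ i))\<^sup>2 * d $ i * t" for t
    unfolding bi tc[symmetric] by (simp add: power2_eq_square)
  have w: "grim_lift i x b \<bullet> grim_lift i x v = d \<bullet> v" for v
    using tb[of "v $ i"] by (simp add: grim_lift_def b_inner)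
  have "surface_gradient ?\<Sigma> f ?p = grim_lift i x b"
    unfolding surface_gradient_def tangent_space_grim_reaper'[OF x]
  proof (rule the_equality)
    fix w' assume w': "w' \<in> ?T \<and> (\<forall>v\<in>?T. w' \<bullet> v = surface_deriv ?\<Sigma> f ?p v)"
    \<comment> \<open>Uniqueness for the definite description: the difference of two candidates is
      tangent and orthogonal to all tangent vectors, hence to itself.\<close>
    have "w' - grim_lift i x b \<in> ?T"
      using w' by (intro subspace_diff[OF subspace_range_grim_lift]) auto
    then obtain v where v: "w' - grim_lift i x b = grim_lift i x v" by blast
    have "(w' - grim_lift i x b) \<bullet> grim_lift i x v = 0"
      using w' w[of v] sd[of v] by (simp add: inner_diff_left)
    then have "w' - grim_lift i x b = 0" unfolding v by simp
    then show "w' = grim_lift i x b" by simp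
  qed (auto simp: w sd)
  then have "(norm (surface_gradient ?\<Sigma> f ?p))\<^sup>2 = d \<bullet> b"
    by (simp add: power2_norm_eq_inner w)
  also have "\<dots> = d \<bullet> d - (sin (x $ i))\<^sup>2 * (d $ i)\<^sup>2"
    using b_inner[of d] by (simp add: inner_commute power2_eq_square)
  finally show ?thesis .
qed

text \<open>The downward normal, for which \<open>H = cos x\<^sub>i\<close> is minus the last
  component. The formula makes sense on the whole space, so it is its own smooth extension.\<close>

definition grim_normal :: "'n::finite \<Rightarrow> (real^'n) \<times> real \<Rightarrow> (real^'n) \<times> real" where
  "grim_normal i p = (sin (fst p $ i) *\<^sub>R axis i 1, - cos (fst p $ i))"

lemma bounded_linear_fst_component: "bounded_linear (\<lambda>p :: (real^'n::finite) \<times> real. fst p $ i)"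
  by (rule bounded_linear_compose[OF bounded_linear_component bounded_linear_fst])

lemma smooth_on_grim_normal: "smooth_on UNIV (grim_normal (i :: 'n::finite))"
proof -
  have lin: "smooth_on UNIV (\<lambda>p :: (real^'n) \<times> real. fst p $ i)"
    by (rule smooth_on_bounded_linear[OF bounded_linear_fst_component open_UNIV])
  have "smooth_on UNIV (\<lambda>p :: (real^'n) \<times> real.
      sin (fst p $ i) *\<^sub>R (axis i 1, 0) + cos (fst p $ i) *\<^sub>R (0, -1 :: real))"
    by (intro smooth_on_add smooth_on_scaleR smooth_on_const open_UNIV
        smooth_on_compose[OF open_UNIV open_UNIV subset_UNIV smooth_on_sin lin]
        smooth_on_compose[OF open_UNIV open_UNIV subset_UNIV smooth_on_cos lin])
  then show ?thesis by (simp add: grim_normal_def[abs_def])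
qed

lemma grim_normal_has_derivative:
  fixes i :: "'n::finite"
  shows   "(grim_normal i has_derivative
     (\<lambda>w. (fst w $ i) *\<^sub>R (cos (fst p $ i) *\<^sub>R axis i 1, sin (fst p $ i)))) (at p)"
proof -
  have c: "((\<lambda>p. fst p $ i) has_derivative (\<lambda>w. fst w $ i)) (at p)"
    by (rule bounded_linear_imp_has_derivative[OF bounded_linear_fst_component])
  have d: "((\<lambda>t. (sin t *\<^sub>R (axis i 1 :: real^'n), - cos t)) has_derivative
      (\<lambda>h. h *\<^sub>R (cos (fst p $ i) *\<^sub>R axis i 1, sin (fst p $ i)))) (at (fst p $ i))"
    by (auto intro!: derivative_eq_intros simp: mult.commute)
  show ?thesis
    unfolding grim_normal_def[abs_def] by (rule has_derivative_compose[OF c d])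
qed

lemma unit_normal_field_grim_normal: "unit_normal_field (grim_reaper_hyperplane i) (grim_normal i)"
  unfolding unit_normal_field_def
proof (intro conjI ballI)
  show "smooth_map_on (grim_reaper_hyperplane i) (grim_normal i)"
    unfolding smooth_map_on_def using smooth_on_grim_normal by blast
next
  fix p assume "p \<in> grim_reaper_hyperplane i"
  then obtain x where p: "p = grim_graph i x" and x: "x \<in> slab i"
    by (auto simp: grim_reaper_hyperplane_eq)
  show "norm (grim_normal i p) = 1"
    by (simp add: grim_normal_def norm_Pair)
  show "grim_normal i p \<bullet> v = 0" if "v \<in> tangent_space (grim_reaper_hyperplane i) p" for v
    using that cos_slab_pos[OF x] unfolding p tangent_space_grim_reaper'[OF x]
    by (auto simp: grim_normal_def grim_lift_def inner_axis' tan_def)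
qed

text \<open>Orthogonality to all lifts determines the horizontal part from the vertical component
  \<open>\<beta>\<close>; unit length then forces
  \<open>\<beta>\<^sup>2 = cos\<^sup>2 x\<^sub>i\<close>.\<close>

lemma unit_normal_grim_reaper_cases:
  assumes "open U" "x \<in> slab i" "grim_graph i x \<in> U"
    and "unit_normal_field (grim_reaper_hyperplane i \<inter> U) \<nu>"
  shows "\<nu> (grim_graph i x) = grim_normal i (grim_graph i x) \<or>
    \<nu> (grim_graph i x) = - grim_normal i (grim_graph i x)"
proof -
  let ?p = "grim_graph i x"
  obtain a \<beta> where ab: "\<nu> ?p = (a, \<beta>)" by fastforce
  have cos: "cos (x $ i) > 0" by (rule cos_slab_pos[OF assms(2)])
  have n: "norm (\<nu> ?p) = 1" and orth: "\<nu> ?p \<bullet> grim_lift i x v = 0" for v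
    using assms tangent_space_grim_reaper[OF assms(1-3)] unfolding unit_normal_field_def by auto
  have "a \<bullet> v = (- (\<beta> * tan (x $ i)) *\<^sub>R axis i 1) \<bullet> v" for v
    using orth[of v] by (simp add: ab grim_lift_def inner_axis' mult.assoc)
  then have a: "a = - (\<beta> * tan (x $ i)) *\<^sub>R axis i 1"
    by (metis vector_eq_rdot)
  have "1 = (norm (\<nu> ?p))\<^sup>2" by (simp add: n)
  also have "\<dots> = \<beta>\<^sup>2 * (1 + (tan (x $ i))\<^sup>2)"
    unfolding power2_norm_eq_inner ab a by (simp add: inner_axis' algebra_simps power2_eq_square)
  also have "1 + (tan (x $ i))\<^sup>2 = 1 / (cos (x $ i))\<^sup>2"
    using cos by (simp add: tan_def field_simps)
  finally have "\<beta>\<^sup>2 = (cos (x $ i))\<^sup>2" using cos by (simp add: field_simps)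
  then have "\<beta> = cos (x $ i) \<or> \<beta> = - cos (x $ i)" by (simp add: power2_eq_iff)
  then show ?thesis
    using cos by (auto simp: ab a grim_normal_def tan_def)
qed

text \<open>Nothing is known about the chosen normal and basis beyond their defining properties. The
  normal equals the explicit one up to a sign that is constant near the point, and the square
  removes the sign. The form is \<open>v\<^sub>i w\<^sub>i / cos x\<^sub>i\<close>, so the double
  sum factors, and Parseval evaluates each factor in any orthonormal basis.\<close>

lemma second_ff_norm_sq_grim_reaper:
  assumes x: "x \<in> slab i"
  shows "second_ff_norm_sq (grim_reaper_hyperplane i) (grim_graph i x) = (cos (x $ i))\<^sup>2"
proof -
  let ?\<Sigma> = "grim_reaper_hyperplane i" and ?p = "grim_graph i x"
  define \<nu> where "\<nu> = (SOME \<nu>. \<exists>U. open U \<and> ?p \<in> U \<and> unit_normal_field (?\<Sigma> \<inter> U) \<nu>)"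
  define B where "B = (SOME B. orthonormal_basis_of (tangent_space ?\<Sigma> ?p) B)"
  have cos: "cos (x $ i) > 0" by (rule cos_slab_pos[OF x])
  have "\<exists>\<nu> U. open U \<and> ?p \<in> U \<and> unit_normal_field (?\<Sigma> \<inter> U) \<nu>"
    using unit_normal_field_grim_normal[of i] by (intro exI[of _ "grim_normal i"] exI[of _ UNIV]) simp
  then have "\<exists>U. open U \<and> ?p \<in> U \<and> unit_normal_field (?\<Sigma> \<inter> U) \<nu>"
    unfolding \<nu>_def by (rule someI_ex)
  then obtain U where U: "open U" "?p \<in> U" and \<nu>: "unit_normal_field (?\<Sigma> \<inter> U) \<nu>" by blast
  have cases: "\<nu> q = grim_normal i q \<or> \<nu> q = - grim_normal i q" if "q \<in> ?\<Sigma> \<inter> U" for q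
    using that unit_normal_grim_reaper_cases[OF U(1) _ _ \<nu>] by (auto simp: grim_reaper_hyperplane_eq)
  obtain s where s: "s = 1 \<or> s = -1" "\<nu> ?p = s *\<^sub>R grim_normal i ?p"
    using cases[of ?p] x U by force
  have unit: "grim_normal i q \<bullet> grim_normal i q = 1" for q
    by (simp add: grim_normal_def inner_axis' power2_eq_square[symmetric])
  obtain U' g where U': "open U'" "?p \<in> U'" "smooth_on U' g"
    and g: "\<And>q. q \<in> U' \<inter> (?\<Sigma> \<inter> U) \<Longrightarrow> \<nu> q = g q"
    using \<nu> U x unfolding unit_normal_field_def smooth_map_on_def by (metis Int_iff grim_graph_in)
  \<comment> \<open>The set where the normal lies on the same side as at \<open>?p\<close>. It is
    open because it is described with the continuous extension \<open>g\<close> instead of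
    \<open>\<nu>\<close>; on it the sign can only be \<open>s\<close>.\<close>
  let ?V = "U' \<inter> (\<lambda>q. s * (g q \<bullet> grim_normal i q)) -` {0<..}"
  have "open ?V"
    by (rule continuous_open_preimage[OF _ U'(1) open_greaterThan])
      (intro continuous_intros smooth_onD_continuous[OF U'(3)]
        continuous_on_subset[OF smooth_onD_continuous[OF smooth_on_grim_normal]] subset_UNIV)
  moreover have "?p \<in> ?V"
  proof -
    have "g ?p = s *\<^sub>R grim_normal i ?p"
      using g[of ?p] s(2) U(2) U'(2) x by simp
    then have "s * (g ?p \<bullet> grim_normal i ?p) = 1" using s(1) unit by auto
    then show ?thesis using U'(2) by simp
  qed
  moreover have \<nu>_eq: "\<nu> q = s *\<^sub>R grim_normal i q" if "q \<in> (U \<inter> ?V) \<inter> ?\<Sigma>" for q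
  proof -
    have gq: "g q = \<nu> q" using g[of q] that by simp
    have "0 < s * (\<nu> q \<bullet> grim_normal i q)" unfolding gq[symmetric] using that by simp
    moreover have "\<nu> q = grim_normal i q \<or> \<nu> q = - grim_normal i q" using cases that by blast
    ultimately show ?thesis using s(1) unit[of q] by (elim disjE) simp_all
  qed
  ultimately have deriv: "surface_deriv ?\<Sigma> \<nu> ?p v =
      s *\<^sub>R ((fst v $ i) *\<^sub>R (cos (x $ i) *\<^sub>R axis i 1, sin (x $ i)))"
    if "v \<in> range (grim_lift i x)" for v
    by (intro surface_deriv_eq[of "U \<inter> ?V" ?p ?\<Sigma> \<nu> "\<lambda>q. s *\<^sub>R grim_normal i q"] has_derivative_scaleR_right
        has_derivative_eq_rhs[OF grim_normal_has_derivative])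
      (use U(1,2) that in \<open>auto simp: tangent_space_grim_reaper'[OF x]\<close>)
  have sff: "second_fundamental_form ?\<Sigma> \<nu> ?p v w = s * (fst v $ i * fst w $ i / cos (x $ i))"
    if "v \<in> range (grim_lift i x)" "w \<in> range (grim_lift i x)" for v w
  proof -
    obtain u where w: "w = grim_lift i x u" using \<open>w \<in> _\<close> by blast
    have c: "cos (x $ i) + sin (x $ i) * tan (x $ i) = 1 / cos (x $ i)"
      using cos sin_cos_squared_add[of "x $ i"] by (simp add: tan_def field_simps power2_eq_square)
    have "(cos (x $ i) *\<^sub>R axis i 1, sin (x $ i)) \<bullet> w = (cos (x $ i) + sin (x $ i) * tan (x $ i)) * u $ i"
      by (simp add: w grim_lift_def inner_axis' distrib_right)
    also have "\<dots> = fst w $ i / cos (x $ i)" unfolding c by (simp add: w grim_lift_def)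
    finally show ?thesis
      unfolding second_fundamental_form_def deriv[OF that(1)] inner_scaleR_left by simp
  qed
  obtain B' where "pairwise orthogonal B'" "\<And>b. b \<in> B' \<Longrightarrow> norm b = 1" "span B' = range (grim_lift i x)"
    by (rule orthonormal_basis_subspace[OF subspace_range_grim_lift[of i x]]) blast
  then have "orthonormal_basis_of (tangent_space ?\<Sigma> ?p) B'"
    unfolding orthonormal_basis_of_def tangent_space_grim_reaper'[OF x] by blast
  then have "orthonormal_basis_of (tangent_space ?\<Sigma> ?p) B"
    unfolding B_def by (rule someI)
  then have B: "pairwise orthogonal B" "\<And>b. b \<in> B \<Longrightarrow> norm b = 1" "span B = range (grim_lift i x)"
    unfolding orthonormal_basis_of_def tangent_space_grim_reaper'[OF x] by blast+
  have "0 \<notin> B" using B(2)[of 0] by auto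
  then have fin: "finite B"
    using pairwise_orthogonal_independent[OF B(1)] independent_bound by blast
  have B_sub: "b \<in> range (grim_lift i x)" if "b \<in> B" for b
    using that B(3) span_base by blast
  \<comment> \<open>The tangential projection of the \<open>i\<close>-th unit vector: it represents
    the functional \<open>b \<mapsto> b\<^sub>i\<close> on the tangent space, so Parseval for
    \<open>t\<close> sums the squares \<open>b\<^sub>i\<^sup>2\<close>.\<close>
  define t where "t = grim_lift i x ((cos (x $ i))\<^sup>2 *\<^sub>R axis i 1)"
  have t_inner: "b \<bullet> t = fst b $ i" if "b \<in> range (grim_lift i x)" for b
  proof -
    obtain u where b: "b = grim_lift i x u" using \<open>b \<in> _\<close> by blast
    have c: "(cos (x $ i))\<^sup>2 + (tan (x $ i))\<^sup>2 * (cos (x $ i))\<^sup>2 = 1"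
      using cos by (simp add: tan_def field_simps)
    have "b \<bullet> t = ((cos (x $ i))\<^sup>2 + (tan (x $ i))\<^sup>2 * (cos (x $ i))\<^sup>2) * u $ i"
      by (simp add: b t_def grim_lift_def inner_axis distrib_right power2_eq_square)
    also have "\<dots> = fst b $ i" unfolding c by (simp add: b grim_lift_def)
    finally show ?thesis .
  qed
  have "t \<in> span B" unfolding B(3) t_def by simp
  from orthonormal_basis_expand[OF B(1,2) this fin]
  have "(\<Sum>b\<in>B. (t \<bullet> b) *\<^sub>R b) \<bullet> t = t \<bullet> t" by simp
  moreover have "t \<bullet> b = fst b $ i" "b \<bullet> t = fst b $ i" if "b \<in> B" for b
    using t_inner[OF B_sub[OF that]] by (simp_all add: inner_commute)
  ultimately have "(\<Sum>b\<in>B. (fst b $ i)\<^sup>2) = t \<bullet> t"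
    by (simp add: inner_sum_left power2_eq_square)
  also have "\<dots> = (cos (x $ i))\<^sup>2"
    by (subst t_inner) (simp_all add: t_def, simp add: grim_lift_def)
  finally have sum: "(\<Sum>b\<in>B. (fst b $ i)\<^sup>2) = (cos (x $ i))\<^sup>2" .
  have "second_ff_norm_sq ?\<Sigma> ?p = (\<Sum>v\<in>B. \<Sum>w\<in>B. (second_fundamental_form ?\<Sigma> \<nu> ?p v w)\<^sup>2)"
    unfolding second_ff_norm_sq_def \<nu>_def[symmetric] B_def[symmetric] Let_def ..
  also have "\<dots> = (\<Sum>v\<in>B. \<Sum>w\<in>B. (fst v $ i)\<^sup>2 * (fst w $ i)\<^sup>2 / (cos (x $ i))\<^sup>2)"
    using s(1) by (intro sum.cong refl) (auto simp: sff B_sub power_mult_distrib power_divide)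
  also have "\<dots> = (\<Sum>v\<in>B. (fst v $ i)\<^sup>2) * (\<Sum>w\<in>B. (fst w $ i)\<^sup>2) / (cos (x $ i))\<^sup>2"
    by (simp add: sum_product sum_divide_distrib)
  also have "\<dots> = (cos (x $ i))\<^sup>2"
    unfolding sum using cos by (simp add: power2_eq_square)
  finally show ?thesis .
qed

section \<open>The area measure of the grim reaper hyperplane\<close>

text \<open>The explicit candidate for the area measure, with density
  \<open>sqrt (1 + tan\<^sup>2 x\<^sub>i) = 1 / cos x\<^sub>i\<close>. The target is the restricted
  Borel space because \<open>is_area_measure\<close> prescribes the measurable sets.\<close>

definition grim_area :: "'n::finite \<Rightarrow> ((real^'n) \<times> real) measure" where
  "grim_area i = distr (density (restrict_space lborel (slab i)) (\<lambda>x. ennreal (1 / cos (x $ i))))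
     (restrict_space borel (grim_reaper_hyperplane i)) (grim_graph i)"

lemma slab_sets [measurable]: "slab i \<in> sets borel"
  by (rule borel_open[OF open_slab])

lemma measurable_grim_graph:
  "grim_graph i \<in> measurable (restrict_space lborel (slab i)) (restrict_space borel (grim_reaper_hyperplane i))"
proof (rule measurable_restrict_space2)
  show "grim_graph i \<in> borel_measurable (restrict_space lborel (slab i))"
    using borel_measurable_continuous_on_restrict[OF smooth_onD_continuous[OF smooth_on_grim_graph]]
    by (subst measurable_cong_sets[OF sets_restrict_space_cong refl]) auto
qed (auto simp: space_restrict_space)

text \<open>The inverse of the graph map is the continuous map \<open>fst\<close>, so an image under
  the graph map is a preimage under \<open>fst\<close>.\<close>

lemma grim_graph_image_sets:
  fixes i :: "'n::finite"
  assumes "E \<in> sets borel" "E \<subseteq> slab i"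
  shows "grim_graph i ` E \<in> sets (restrict_space borel (grim_reaper_hyperplane i))"
proof -
  have "fst -` E \<inter> space borel \<in> sets (borel :: ((real^'n) \<times> real) measure)"
    by (rule measurable_sets[OF _ assms(1)]) (simp add: borel_prod[symmetric])
  moreover have "grim_graph i ` E = grim_reaper_hyperplane i \<inter> (fst -` E \<inter> space borel)"
    using assms(2) in_grim_reaperD by (fastforce simp: image_iff)
  ultimately show ?thesis unfolding sets_restrict_space by blast
qed

lemma emeasure_grim_area:
  assumes E: "E \<in> sets borel" "E \<subseteq> slab i"
  shows "emeasure (grim_area i) (grim_graph i ` E) = (\<integral>\<^sup>+x\<in>E. ennreal (1 / cos (x $ i)) \<partial>lborel)"
proof -
  have slab: "slab i \<inter> space lborel \<in> sets lborel" by simp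
  have E': "E \<in> sets (restrict_space lborel (slab i))"
    using E by (auto simp: sets_restrict_space_iff)
  have pre: "grim_graph i -` (grim_graph i ` E) \<inter> slab i = E"
    using E(2) by (auto simp: grim_graph_def)
  have "emeasure (grim_area i) (grim_graph i ` E) =
      (\<integral>\<^sup>+x. ennreal (1 / cos (x $ i)) * indicator E x \<partial>restrict_space lborel (slab i))"
    unfolding grim_area_def using grim_graph_image_sets[OF E] measurable_grim_graph[of i] E'
    by (simp add: emeasure_distr pre space_restrict_space emeasure_density measurable_restrict_space1)
  also have "\<dots> = (\<integral>\<^sup>+x\<in>E. ennreal (1 / cos (x $ i)) \<partial>lborel)"
    unfolding nn_integral_restrict_space[OF slab]
    by (rule nn_integral_cong) (use E(2) in \<open>auto simp: indicator_def\<close>)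
  finally show ?thesis .
qed

text \<open>Every chart factors through the graph map as \<open>grim_graph i\<close> after
  \<open>fst \<circ> \<phi>\<close>; the chain rule therefore expresses its derivative by that of
  the horizontal part.\<close>

lemma grim_chart_derivative:
  fixes \<phi> :: "real^'n::finite \<Rightarrow> (real^'n) \<times> real"
  assumes U: "open U" "u \<in> U" and \<phi>: "smooth_on U \<phi>" "\<phi> ` U \<subseteq> grim_reaper_hyperplane i"
  shows "((\<lambda>u. fst (\<phi> u)) has_derivative (\<lambda>v. fst (frechet_derivative \<phi> (at u) v))) (at u)"
    and "frechet_derivative \<phi> (at u) v = grim_lift i (fst (\<phi> u)) (fst (frechet_derivative \<phi> (at u) v))"
proof -
  have der: "(\<phi> has_derivative frechet_derivative \<phi> (at u)) (at u)"
    using smooth_on_derivative[OF \<phi>(1)] U(2) frechet_derivative_at by metis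
  then show fst: "((\<lambda>u. fst (\<phi> u)) has_derivative (\<lambda>v. fst (frechet_derivative \<phi> (at u) v))) (at u)"
    by (rule bounded_linear.has_derivative[OF bounded_linear_fst])
  have slab: "fst (\<phi> u) \<in> slab i" using \<phi>(2) U(2) in_grim_reaperD by fast
  have "((\<lambda>u. grim_graph i (fst (\<phi> u))) has_derivative
      (\<lambda>v. grim_lift i (fst (\<phi> u)) (fst (frechet_derivative \<phi> (at u) v)))) (at u)"
    using has_derivative_compose[OF fst grim_graph_has_derivative[OF slab]] by (simp add: grim_lift_def)
  moreover have "grim_graph i (fst (\<phi> y)) = \<phi> y" if "y \<in> U" for y
    using in_grim_reaperD[of "\<phi> y" i] \<phi>(2) that by (simp add: image_subset_iff)
  ultimately have "(\<phi> has_derivative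
      (\<lambda>v. grim_lift i (fst (\<phi> u)) (fst (frechet_derivative \<phi> (at u) v)))) (at u)"
    using has_derivative_transform_within_open[of "\<lambda>u. grim_graph i (fst (\<phi> u))" _ u UNIV U \<phi>] U by simp
  from has_derivative_unique[OF der this]
  show "frechet_derivative \<phi> (at u) v = grim_lift i (fst (\<phi> u)) (fst (frechet_derivative \<phi> (at u) v))"
    by metis
qed

text \<open>The metric transforms as \<open>M\<^sup>T G M\<close>, where \<open>M\<close> is the
  Jacobian matrix of the horizontal part and \<open>G\<close> the metric of the graph chart. Here
  \<open>det G = 1 + tan\<^sup>2 = 1 / cos\<^sup>2\<close>, and the square root leaves |det
  M|.\<close>

lemma sqrt_det_metric_matrix_grim_chart:
  fixes \<phi> :: "real^'n::finite \<Rightarrow> (real^'n) \<times> real"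
  assumes "open U" "u \<in> U" "smooth_on U \<phi>" "\<phi> ` U \<subseteq> grim_reaper_hyperplane i"
  shows "sqrt (det (metric_matrix \<phi> u)) =
    1 / cos (fst (\<phi> u) $ i) * \<bar>det (matrix (\<lambda>v. fst (frechet_derivative \<phi> (at u) v)))\<bar>"
proof -
  define M where "M = matrix (\<lambda>v. fst (frechet_derivative \<phi> (at u) v))"
  define c where "c = cos (fst (\<phi> u) $ i)"
  define \<tau> where "\<tau> = tan (fst (\<phi> u) $ i)"
  define G where "G = ((\<chi> j k. if j = k then (if j = i then 1 + \<tau>\<^sup>2 else 1) else 0) :: real^'n^'n)"
  have "fst (\<phi> u) \<in> slab i" using assms in_grim_reaperD by fast
  then have c: "c > 0" unfolding c_def by (rule cos_slab_pos)
  have entry: "metric_matrix \<phi> u $ a $ b = (transpose M ** (G ** M)) $ a $ b" for a b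
  proof -
    have col: "fst (frechet_derivative \<phi> (at u) (axis a 1)) $ j = M $ j $ a" for a j
      by (simp add: M_def matrix_def)
    have GM: "(G ** M) $ j $ b = M $ j $ b + (if j = i then \<tau>\<^sup>2 * M $ i $ b else 0)" for j
    proof -
      have "(G ** M) $ j $ b = (\<Sum>k\<in>UNIV. if k = j then (if j = i then 1 + \<tau>\<^sup>2 else 1) * M $ k $ b else 0)"
        unfolding matrix_matrix_mult_def vec_lambda_beta by (rule sum.cong) (auto simp: G_def)
      then show ?thesis by (simp add: algebra_simps)
    qed
    have "metric_matrix \<phi> u $ a $ b = (\<Sum>j\<in>UNIV. M $ j $ a * M $ j $ b) + \<tau>\<^sup>2 * M $ i $ a * M $ i $ b"
      unfolding metric_matrix_def
      by (simp, subst (1 2) grim_chart_derivative(2)[OF assms])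
        (simp add: grim_lift_def inner_vec_def col \<tau>_def power2_eq_square)
    also have "\<dots> = (\<Sum>j\<in>UNIV. M $ j $ a * (G ** M) $ j $ b)"
    proof -
      have "(\<Sum>j\<in>UNIV. M $ j $ a * (G ** M) $ j $ b) =
          (\<Sum>j\<in>UNIV. M $ j $ a * M $ j $ b + (if j = i then \<tau>\<^sup>2 * M $ i $ a * M $ i $ b else 0))"
        by (rule sum.cong) (auto simp: GM distrib_left)
      then show ?thesis by (simp add: sum.distrib)
    qed
    also have "\<dots> = (transpose M ** (G ** M)) $ a $ b"
      by (simp only: matrix_matrix_mult_def[of "transpose M"] vec_lambda_beta) (simp add: transpose_def)
    finally show ?thesis .
  qed
  then have "metric_matrix \<phi> u = transpose M ** (G ** M)" by (simp add: vec_eq_iff)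
  then have "det (metric_matrix \<phi> u) = det G * (det M)\<^sup>2"
    by (simp add: det_mul det_transpose power2_eq_square)
  also have "det G = (\<Prod>j\<in>UNIV. G $ j $ j)" by (rule det_diagonal) (simp add: G_def)
  also have "\<dots> = 1 + \<tau>\<^sup>2" by (simp add: G_def prod.delta)
  also have "\<dots> = (1 / c)\<^sup>2" using c by (simp add: \<tau>_def c_def tan_def field_simps)
  finally show ?thesis
    using c by (simp add: real_sqrt_mult power_divide real_sqrt_divide M_def c_def)
qed

text \<open>An arbitrary chart differs from the graph chart by the transition map
  \<open>h = fst \<circ> \<phi>\<close>. The required density formula is then the change of
  variables for \<open>h\<close>, whose Jacobian is exactly the extra factor in the metric
  determinant.\<close>

lemma is_area_measure_grim_area:
  fixes i :: "'n::finite"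
  shows "is_area_measure TYPE('n) (grim_reaper_hyperplane i) (grim_area i)"
  unfolding is_area_measure_def
proof (intro conjI allI impI)
  let ?\<Sigma> = "grim_reaper_hyperplane i"
  show "sets (grim_area i) = sets (restrict_space borel ?\<Sigma>)"
    by (simp add: grim_area_def)
  fix U :: "(real^'n) set" and \<phi> :: "real^'n \<Rightarrow> (real^'n) \<times> real" and E
  assume "local_parametrization ?\<Sigma> U \<phi>" and E: "E \<in> sets borel \<and> E \<subseteq> U"
  then obtain \<psi> where U: "open U" and \<phi>: "smooth_on U \<phi>" and op: "openin (top_of_set ?\<Sigma>) (\<phi> ` U)"
    and \<psi>: "homeomorphism U (\<phi> ` U) \<phi> \<psi>"
    unfolding local_parametrization_def by blast
  from op obtain W where W: "open W" "\<phi> ` U = ?\<Sigma> \<inter> W" by (auto simp: openin_open)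
  then have sub: "\<phi> ` U \<subseteq> ?\<Sigma>" by blast
  define h where "h u = fst (\<phi> u)" for u
  define h' where "h' u v = fst (frechet_derivative \<phi> (at u) v)" for u v
  have gh: "grim_graph i (h u) = \<phi> u" "h u \<in> slab i" if "u \<in> U" for u
    using in_grim_reaperD[of "\<phi> u" i] sub that by (simp_all add: image_subset_iff h_def)
  define V where "V = slab i \<inter> grim_graph i -` W"
  have contg: "continuous_on (slab i) (grim_graph i)"
    by (rule smooth_onD_continuous[OF smooth_on_grim_graph])
  have V: "open V" unfolding V_def by (rule continuous_open_preimage[OF contg open_slab W(1)])
  have gV: "grim_graph i ` V \<subseteq> \<phi> ` U" using W(2) by (simp add: V_def image_subset_iff)
  have k: "continuous_on V (\<lambda>x. \<psi> (grim_graph i x))"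
    by (rule continuous_on_compose2[OF homeomorphism_cont2[OF \<psi>] continuous_on_subset[OF contg] gV])
      (simp add: V_def)
  \<comment> \<open>The inverse of \<open>h\<close> is \<open>\<psi>\<close> after the graph map,
    continuous on the open set \<open>V\<close>. Images under \<open>h\<close> thus become
    preimages, which makes images of Borel sets Borel.\<close>
  have h_image: "h ` E' = V \<inter> (\<lambda>x. \<psi> (grim_graph i x)) -` E'" if "E' \<subseteq> U" for E'
  proof (intro equalityI subsetI)
    fix x assume "x \<in> h ` E'"
    then obtain u where u: "u \<in> E'" "x = h u" by blast
    then have "\<psi> (grim_graph i x) = u" "x \<in> V"
      using that gh[of u] homeomorphism_apply1[OF \<psi>, of u] W(2) by (auto simp: V_def)
    then show "x \<in> V \<inter> (\<lambda>x. \<psi> (grim_graph i x)) -` E'" using u by simp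
  next
    fix x assume x: "x \<in> V \<inter> (\<lambda>x. \<psi> (grim_graph i x)) -` E'"
    then have "\<phi> (\<psi> (grim_graph i x)) = grim_graph i x"
      using gV homeomorphism_apply2[OF \<psi>] by blast
    then have "h (\<psi> (grim_graph i x)) = x" by (simp add: h_def)
    then show "x \<in> h ` E'" using x by force
  qed
  have h_sets: "h ` E' \<in> sets borel" if "E' \<in> sets borel" "E' \<subseteq> U" for E'
  proof -
    have "(\<lambda>x. \<psi> (grim_graph i x)) -` E' \<inter> space (restrict_space borel V) \<in> sets (restrict_space borel V)"
      by (rule measurable_sets[OF borel_measurable_continuous_on_restrict[OF k] that(1)])
    then show ?thesis
      unfolding h_image[OF that(2)] using V
      by (simp add: space_restrict_space sets_restrict_space_iff Int_commute)
  qed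
  have der: "(h has_derivative h' u) (at u)" if "u \<in> U" for u
    using grim_chart_derivative(1)[OF U that \<phi> sub] unfolding h_def[abs_def] h'_def[abs_def] .
  have contd: "continuous_on U (\<lambda>u. frechet_derivative \<phi> (at u) v)" for v
    using \<phi> unfolding smooth_on_def by (metis Ck_on.simps)
  have "continuous_on U (\<lambda>u. det (matrix (h' u)))"
    unfolding det_def matrix_def h'_def by (simp, intro continuous_intros contd)
  then have cont': "continuous_on E (\<lambda>u. det (matrix (h' u)))"
    using E continuous_on_subset by blast
  have "\<phi> ` E = grim_graph i ` h ` E" using gh E by (force simp: image_image)
  moreover have "h ` E \<subseteq> slab i" using gh(2) E by blast
  ultimately have "emeasure (grim_area i) (\<phi> ` E) = (\<integral>\<^sup>+x\<in>h ` E. ennreal (1 / cos (x $ i)) \<partial>lborel)"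
    using emeasure_grim_area[OF h_sets] E by simp
  also have "\<dots> = (\<integral>\<^sup>+u\<in>E. ennreal (1 / cos (h u $ i)) * ennreal \<bar>det (matrix (h' u))\<bar> \<partial>lborel)"
  proof (rule nn_integral_differentiable_image[OF _ _ _ _ _ cont'])
    show "continuous_on E h"
      using E unfolding h_def[abs_def]
      by (intro continuous_on_fst continuous_on_subset[OF smooth_onD_continuous[OF \<phi>]]) simp
    have "inj_on h U" by (rule inj_onI) (metis gh(1) homeomorphism_apply1[OF \<psi>])
    then show "inj_on h E" using E inj_on_subset by blast
  qed (use E h_sets der in auto)
  also have "\<dots> = (\<integral>\<^sup>+u\<in>E. ennreal (sqrt (det (metric_matrix \<phi> u))) \<partial>lborel)"
  proof (rule nn_integral_cong)
    fix u
    show "ennreal (1 / cos (h u $ i)) * ennreal \<bar>det (matrix (h' u))\<bar> * indicator E u =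
        ennreal (sqrt (det (metric_matrix \<phi> u))) * indicator E u"
    proof (cases "u \<in> E")
      case True
      then have u: "u \<in> U" using E by blast
      have sec: "0 \<le> 1 / cos (h u $ i)" using cos_slab_pos[OF gh(2)[OF u]] by simp
      show ?thesis
        unfolding sqrt_det_metric_matrix_grim_chart[OF U u \<phi> sub] h_def[symmetric] h'_def[abs_def]
        by (simp only: ennreal_mult[OF sec abs_ge_zero])
    qed simp
  qed
  finally show "emeasure (grim_area i) (\<phi> ` E) =
      (\<integral>\<^sup>+u\<in>E. ennreal (sqrt (det (metric_matrix \<phi> u))) \<partial>lborel)" .
qed

section \<open>Uniqueness of the area measure\<close>

lemma local_parametrization_grim_graph:
  "local_parametrization (grim_reaper_hyperplane i) (slab i) (grim_graph i)"
  unfolding local_parametrization_def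
proof (intro conjI ballI exI)
  show "inj (frechet_derivative (grim_graph i) (at u))" if "u \<in> slab i" for u
    unfolding frechet_derivative_at[OF grim_graph_has_derivative[OF that], symmetric]
    by (auto intro: injI)
  show "openin (top_of_set (grim_reaper_hyperplane i)) (grim_graph i ` slab i)"
    by (simp add: grim_reaper_hyperplane_eq)
  show "homeomorphism (slab i) (grim_graph i ` slab i) (grim_graph i) fst"
    by (rule homeomorphismI)
      (auto intro: smooth_onD_continuous[OF smooth_on_grim_graph] continuous_intros)
qed (rule open_slab smooth_on_grim_graph)+

text \<open>The graph chart is global: every measurable subset of the hypersurface is the image of a
  Borel subset of the slab, so this single chart already fixes the measure.\<close>

lemma area_measure_grim_reaper:
  fixes i :: "'n::finite"
  shows "area_measure TYPE('n) (grim_reaper_hyperplane i) = grim_area i"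
  unfolding area_measure_def
proof (rule the_equality)
  show "is_area_measure TYPE('n) (grim_reaper_hyperplane i) (grim_area i)"
    by (rule is_area_measure_grim_area)
next
  let ?\<Sigma> = "grim_reaper_hyperplane i"
  fix \<mu> assume \<mu>: "is_area_measure TYPE('n) ?\<Sigma> \<mu>"
  show "\<mu> = grim_area i"
  proof (rule measure_eqI)
    show sets: "sets \<mu> = sets (grim_area i)"
      using \<mu> is_area_measure_grim_area[of i] unfolding is_area_measure_def by simp
    fix A assume "A \<in> sets \<mu>"
    then have A: "A \<in> sets (restrict_space borel ?\<Sigma>)" using \<mu> unfolding is_area_measure_def by simp
    define E where "E = grim_graph i -` A \<inter> space (restrict_space lborel (slab i))"
    have "E \<in> sets (restrict_space lborel (slab i))"
      unfolding E_def by (rule measurable_sets[OF measurable_grim_graph A])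
    then have E: "E \<in> sets borel \<and> E \<subseteq> slab i"
      by (simp add: sets_restrict_space_iff)
    have "A \<subseteq> ?\<Sigma>" using A by (auto simp: sets_restrict_space)
    then have "A = grim_graph i ` E"
      using in_grim_reaperD by (fastforce simp: E_def space_restrict_space image_iff)
    then show "emeasure \<mu> A = emeasure (grim_area i) A"
      using \<mu> is_area_measure_grim_area[of i] E local_parametrization_grim_graph[of i]
      unfolding is_area_measure_def by simp
  qed
qed

section \<open>The Rayleigh quotient in graph coordinates\<close>

text \<open>The integrands of the Rayleigh quotient involve definite descriptions and choices, so
  their measurability is obtained from the continuous function \<open>N \<circ> fst\<close>, with
  which \<open>f\<close> agrees on the hypersurface.\<close>

lemma integral_grim_area:
  fixes i :: "'n::finite" and N :: "real^'n \<Rightarrow> real"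
  assumes N: "continuous_on (slab i) N" and eq: "\<And>x. x \<in> slab i \<Longrightarrow> f (grim_graph i x) = N x"
  shows "(\<integral>p. f p \<partial>grim_area i) = (\<integral>x. indicator (slab i) x * (N x / cos (x $ i)) \<partial>lborel)"
proof -
  let ?\<Sigma> = "grim_reaper_hyperplane i" and ?M = "restrict_space lborel (slab i)"
  have fst: "fst ` ?\<Sigma> \<subseteq> slab i" using in_grim_reaperD by blast
  have f_eq: "f p = N (fst p)" if "p \<in> ?\<Sigma>" for p
    using eq in_grim_reaperD[OF that] by metis
  have "continuous_on ?\<Sigma> (\<lambda>p. N (fst p))"
    by (rule continuous_on_compose2[OF N _ fst]) (intro continuous_intros)
  then have "(\<lambda>p. N (fst p)) \<in> borel_measurable (restrict_space borel ?\<Sigma>)"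
    by (rule borel_measurable_continuous_on_restrict)
  then have f: "f \<in> borel_measurable (restrict_space borel ?\<Sigma>)"
    by (subst measurable_cong[of _ f "\<lambda>p. N (fst p)"]) (auto simp: space_restrict_space f_eq)
  have g: "grim_graph i \<in> measurable (density ?M (\<lambda>x. ennreal (1 / cos (x $ i)))) (restrict_space borel ?\<Sigma>)"
    using measurable_grim_graph[of i] by simp
  have sec: "(\<lambda>x. 1 / cos (x $ i)) \<in> borel_measurable ?M"
    by (intro measurable_restrict_space1) simp
  have "(\<integral>p. f p \<partial>grim_area i) = (\<integral>x. f (grim_graph i x) \<partial>density ?M (\<lambda>x. ennreal (1 / cos (x $ i))))"
    unfolding grim_area_def by (rule integral_distr[OF g f])
  also have "\<dots> = (\<integral>x. (1 / cos (x $ i)) *\<^sub>R f (grim_graph i x) \<partial>?M)"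
  proof (rule integral_density[OF _ sec])
    show "(\<lambda>x. f (grim_graph i x)) \<in> borel_measurable ?M"
      using measurable_compose[OF measurable_grim_graph f] .
    show "AE x in ?M. 0 \<le> 1 / cos (x $ i)"
      by (rule AE_I2) (auto simp: space_restrict_space dest: cos_slab_pos)
  qed
  also have "\<dots> = (\<integral>x. indicator (slab i) x *\<^sub>R ((1 / cos (x $ i)) *\<^sub>R f (grim_graph i x)) \<partial>lborel)"
    by (rule integral_restrict_space) simp
  also have "\<dots> = (\<integral>x. indicator (slab i) x * (N x / cos (x $ i)) \<partial>lborel)"
    by (rule Bochner_Integration.integral_cong) (auto simp: indicator_def eq)
  finally show ?thesis .
qed

text \<open>
  In graph coordinates the weighted area is \<open>dx / cos\<^sup>2 x\<^sub>i\<close>.  The energy is rewritten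
  with the positive Jacobi field \<open>cos x\<^sub>i\<close>:
  \<open>d\<^sub>i\<^sup>2 - F\<^sup>2 = (d\<^sub>i + F tan x\<^sub>i)\<^sup>2 - \<partial>\<^sub>i (F\<^sup>2 tan x\<^sub>i)\<close>,
  and the last term integrates to zero.
\<close>

lemma rayleigh_quotient_grim_reaper:
  fixes i :: "'n::finite" and f :: "(real^'n) \<times> real \<Rightarrow> real" and d :: "real^'n \<Rightarrow> real^'n"
  assumes F_def: "\<And>x. f (grim_graph i x) = F x"
    and f: "test_function (grim_reaper_hyperplane i) f"
    and der: "\<And>x. x \<in> slab i \<Longrightarrow> (F has_derivative (\<lambda>v. d x \<bullet> v)) (at x)"
    and d: "continuous_on (slab i) d"
  shows "rayleigh_quotient (grim_reaper_hyperplane i) f =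
    (\<integral>x. indicator (slab i) x * ((d x \<bullet> d x - (d x $ i)\<^sup>2) / (cos (x $ i))\<^sup>2 +
       (d x $ i + F x * tan (x $ i))\<^sup>2) \<partial>lborel) /
    (\<integral>x. indicator (slab i) x * (F x / cos (x $ i))\<^sup>2 \<partial>lborel)"
proof -
  let ?\<Sigma> = "grim_reaper_hyperplane i"
  have cos: "cos (x $ i) > 0" if "x \<in> slab i" for x using that by (rule cos_slab_pos)
  have F: "continuous_on (slab i) F"
    using der by (auto intro!: continuous_at_imp_continuous_on has_derivative_continuous)
  define Q where "Q x = indicator (slab i) x * ((d x \<bullet> d x - (d x $ i)\<^sup>2) / (cos (x $ i))\<^sup>2 +
      (d x $ i + F x * tan (x $ i))\<^sup>2)" for x
  have tan: "continuous_on (slab i) (\<lambda>x. tan (x $ i))"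
    unfolding tan_def by (intro continuous_intros) (auto dest: cos_slab_pos)
  define N where "N x = (d x \<bullet> d x - (sin (x $ i))\<^sup>2 * (d x $ i)\<^sup>2 - (cos (x $ i))\<^sup>2 * (F x)\<^sup>2) / cos (x $ i)" for x
  have exp: "exp (snd (grim_graph i x)) = 1 / cos (x $ i)" if "x \<in> slab i" for x
    using cos[OF that] by (simp add: grim_graph_def exp_minus inverse_eq_divide)
  have num: "(\<integral>p. ((norm (surface_gradient ?\<Sigma> f p))\<^sup>2 - second_ff_norm_sq ?\<Sigma> p * (f p)\<^sup>2) * exp (snd p) \<partial>grim_area i)
      = (\<integral>x. indicator (slab i) x * (N x / cos (x $ i)) \<partial>lborel)"
  proof (rule integral_grim_area)
    show "continuous_on (slab i) N"
      unfolding N_def by (intro continuous_intros d F) (auto dest: cos_slab_pos)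
    fix x assume x: "x \<in> slab i"
    from norm_surface_gradient_grim_reaper[OF x, of f "d x"] der[OF x] F_def
    show "((norm (surface_gradient ?\<Sigma> f (grim_graph i x)))\<^sup>2 -
        second_ff_norm_sq ?\<Sigma> (grim_graph i x) * (f (grim_graph i x))\<^sup>2) * exp (snd (grim_graph i x)) = N x"
      by (simp add: N_def F_def exp[OF x] second_ff_norm_sq_grim_reaper[OF x])
  qed
  have den: "(\<integral>p. (f p)\<^sup>2 * exp (snd p) \<partial>grim_area i) =
      (\<integral>x. indicator (slab i) x * (((F x)\<^sup>2 / cos (x $ i)) / cos (x $ i)) \<partial>lborel)"
  proof (rule integral_grim_area)
    show "continuous_on (slab i) (\<lambda>x. (F x)\<^sup>2 / cos (x $ i))"
      by (intro continuous_intros F) (auto dest: cos_slab_pos)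
  qed (simp add: F_def exp)
  \<comment> \<open>The horizontal shadow of the support. Being compact inside the open slab, it
    stays away from the walls, where the tangent blows up.\<close>
  define K where "K = fst ` (?\<Sigma> \<inter> closure {p \<in> ?\<Sigma>. f p \<noteq> 0})"
  have K: "compact K" "K \<subseteq> slab i"
    using f in_grim_reaperD unfolding K_def test_function_def
    by (auto intro!: compact_continuous_image continuous_intros)
  have F0: "F x = 0" if "x \<in> slab i" "x \<notin> K" for x
  proof (rule ccontr)
    assume "F x \<noteq> 0"
    then have "grim_graph i x \<in> ?\<Sigma> \<inter> closure {p \<in> ?\<Sigma>. f p \<noteq> 0}"
      using that(1) closure_subset[of "{p \<in> ?\<Sigma>. f p \<noteq> 0}"] by (auto simp: F_def)
    then have "x \<in> K" unfolding K_def by force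
    with that(2) show False ..
  qed
  have opK: "open (- K)" using K(1) compact_imp_closed by blast
  have cover: "UNIV = slab i \<union> - K" using K(2) by blast
  \<comment> \<open>The function whose \<open>i\<close>-th derivative is the exact term. Its
    extension by 0 is differentiable everywhere, because the slab and the complement of
    \<open>K\<close> are open, cover the space, and \<open>W\<close> vanishes on the latter.\<close>
  define W where "W x = (if x \<in> slab i then (F x)\<^sup>2 * tan (x $ i) else 0)" for x
  define W' where "W' x v = (if x \<in> slab i then 2 * F x * (d x \<bullet> v) * tan (x $ i) +
      (F x)\<^sup>2 * ((1 + (tan (x $ i))\<^sup>2) * v $ i) else 0)" for x v
  have W0: "W x = 0" if "x \<notin> K" for x using that F0 by (simp add: W_def)
  have W'0: "W' x v = 0" if "x \<notin> K" for x v using that F0 by (simp add: W'_def)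
  have derW: "(W has_derivative W' x) (at x)" for x
  proof (cases "x \<in> slab i")
    case True
    have c: "((\<lambda>x. x $ i) has_derivative (\<lambda>v. v $ i)) (at x)"
      by (rule bounded_linear_imp_has_derivative[OF bounded_linear_component])
    have "(tan has_derivative (\<lambda>h. (1 + (tan (x $ i))\<^sup>2) * h)) (at (x $ i))"
      using DERIV_tan[of "x $ i"] cos[OF True] by (simp add: has_field_derivative_def tan_sec power_inverse)
    from has_derivative_compose[OF c this]
    have t: "((\<lambda>x. tan (x $ i)) has_derivative (\<lambda>v. (1 + (tan (x $ i))\<^sup>2) * v $ i)) (at x)" .
    have "((\<lambda>x. F x * F x * tan (x $ i)) has_derivative W' x) (at x)"
      by (rule has_derivative_eq_rhs[OF has_derivative_mult[OF has_derivative_mult[OF der[OF True] der[OF True]] t]])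
        (auto simp: W'_def True algebra_simps power2_eq_square)
    then show ?thesis
      by (rule has_derivative_transform_within_open[OF _ open_slab True]) (simp add: W_def power2_eq_square)
  next
    case False
    then have "x \<in> - K" using K(2) by blast
    moreover have "W' x = (\<lambda>v. 0)" using False by (simp add: W'_def fun_eq_iff)
    ultimately show ?thesis
      using W0 by (auto intro!: has_derivative_transform_within_open[OF has_derivative_const[of 0] opK])
  qed
  have contW': "continuous_on UNIV (\<lambda>x. W' x (axis i 1))"
    unfolding cover
  proof (rule continuous_on_open_Un[OF open_slab opK])
    have "continuous_on (slab i) (\<lambda>x. 2 * F x * (d x \<bullet> axis i 1) * tan (x $ i) +
        (F x)\<^sup>2 * ((1 + (tan (x $ i))\<^sup>2) * axis i 1 $ i))"
      by (intro continuous_intros F d tan)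
    then show "continuous_on (slab i) (\<lambda>x. W' x (axis i 1))"
      by (rule continuous_on_eq) (simp add: W'_def)
    have "continuous_on (- K) (\<lambda>x. 0 :: real)" by simp
    then show "continuous_on (- K) (\<lambda>x. W' x (axis i 1))"
      by (rule continuous_on_eq) (simp add: W'0)
  qed
  note W' = integral_directional_derivative_eq_0[OF derW contW' K(1) W0]
  have "indicator (slab i) x * (N x / cos (x $ i)) = Q x - W' x (axis i 1)" for x
  proof (cases "x \<in> slab i")
    case True
    have "N x / cos (x $ i) = (d x \<bullet> d x - (1 - (cos (x $ i))\<^sup>2) * (d x $ i)\<^sup>2 - (cos (x $ i))\<^sup>2 * (F x)\<^sup>2) / (cos (x $ i))\<^sup>2"
      by (simp only: N_def sin_squared_eq) (simp add: power2_eq_square)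
    also have "\<dots> = (d x \<bullet> d x - (d x $ i)\<^sup>2) / (cos (x $ i))\<^sup>2 + (d x $ i)\<^sup>2 - (F x)\<^sup>2"
      using cos[OF True] by (simp add: field_simps)
    also have "\<dots> = Q x - W' x (axis i 1)"
      using True by (simp add: Q_def W'_def inner_axis algebra_simps power2_eq_square)
    finally show ?thesis using True by simp
  qed (simp add: Q_def W'_def)
  then have num': "(\<integral>x. indicator (slab i) x * (N x / cos (x $ i)) \<partial>lborel) = (\<integral>x. Q x - W' x (axis i 1) \<partial>lborel)"
    by simp
  \<comment> \<open>The derivative term is integrable, so \<open>Q\<close> and the difference are
    integrable together. If neither is, both integrals are 0 by convention and the equality still
    holds.\<close>
  have "\<dots> = (\<integral>x. Q x \<partial>lborel)"
  proof (cases "integrable lborel Q")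
    case True
    then show ?thesis using W' by simp
  next
    case False
    then have "\<not> integrable lborel (\<lambda>x. Q x - W' x (axis i 1))"
      using Bochner_Integration.integrable_add[OF _ W'(1), of "\<lambda>x. Q x - W' x (axis i 1)"] by auto
    with False show ?thesis by (simp add: not_integrable_integral_eq)
  qed
  then show ?thesis
    unfolding rayleigh_quotient_def area_measure_grim_reaper num den num' Q_def
    by (simp add: power_divide power2_eq_square)
qed

text \<open>After the rewriting, the off-axis energy and the completed square are both nonnegative.
  The values that the conventions assign to non-integrable functions and to division by 0 respect
  this sign.\<close>

lemma rayleigh_quotient_grim_reaper_nonneg:
  fixes i :: "'n::finite"
  assumes f: "test_function (grim_reaper_hyperplane i) f"
  shows "0 \<le> rayleigh_quotient (grim_reaper_hyperplane i) f"
proof -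
  define F where "F x = f (grim_graph i x)" for x
  have "smooth_on (slab i) F"
    using smooth_on_pullback f unfolding test_function_def F_def[abs_def] by blast
  from smooth_on_derivative[OF this] obtain F' where F': "\<And>x. x \<in> slab i \<Longrightarrow> (F has_derivative F' x) (at x)"
    and cont: "\<And>v. continuous_on (slab i) (\<lambda>x. F' x v)" by blast
  define d where "d x = (\<chi> j. F' x (axis j 1))" for x
  have "F' x v = d x \<bullet> v" if "x \<in> slab i" for x v
  proof -
    interpret linear "F' x" using F'[OF that] by (rule has_derivative_linear)
    have "F' x v = F' x (\<Sum>j\<in>UNIV. v $ j *\<^sub>R axis j 1)"
      by (simp only: basis_expansion flip: scalar_mult_eq_scaleR)
    also have "\<dots> = d x \<bullet> v"
      by (simp add: sum scaleR d_def inner_vec_def mult.commute)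
    finally show ?thesis .
  qed
  then have der: "(F has_derivative (\<lambda>v. d x \<bullet> v)) (at x)" if "x \<in> slab i" for x
    using F'[OF that] ext[of "F' x" "\<lambda>v. d x \<bullet> v"] that by simp
  have d: "continuous_on (slab i) d"
    unfolding d_def[abs_def] by (intro continuous_on_vec_lambda cont)
  have "0 \<le> (\<integral>x. indicator (slab i) x * ((d x \<bullet> d x - (d x $ i)\<^sup>2) / (cos (x $ i))\<^sup>2 +
       (d x $ i + F x * tan (x $ i))\<^sup>2) \<partial>lborel) /
    (\<integral>x. indicator (slab i) x * (F x / cos (x $ i))\<^sup>2 \<partial>lborel)"
  proof (intro divide_nonneg_nonneg Bochner_Integration.integral_nonneg)
    fix x
    have "(d x $ i)\<^sup>2 \<le> d x \<bullet> d x"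
      using component_le_norm_cart[of "d x" i] by (simp add: abs_le_square_iff[symmetric] flip: power2_norm_eq_inner)
    then show "0 \<le> indicator (slab i) x * ((d x \<bullet> d x - (d x $ i)\<^sup>2) / (cos (x $ i))\<^sup>2 +
        (d x $ i + F x * tan (x $ i))\<^sup>2)"
      by (intro mult_nonneg_nonneg add_nonneg_nonneg divide_nonneg_nonneg) auto
  qed auto
  also have "\<dots> = rayleigh_quotient (grim_reaper_hyperplane i) f"
    by (rule rayleigh_quotient_grim_reaper[OF F_def[symmetric] f der d, symmetric])
  finally show ?thesis .
qed

section \<open>Test functions with small Rayleigh quotient\<close>

lemma measure_box_around_axis:
  fixes i :: "'n::finite" and p q r :: real
  assumes "p \<le> q" "0 \<le> r"
  defines "S \<equiv> {x :: real^'n. p \<le> x $ i \<and> x $ i \<le> q \<and> (\<forall>j. j \<noteq> i \<longrightarrow> \<bar>x $ j\<bar> \<le> r)}"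
  shows "S \<in> sets borel" "measure lborel S = (q - p) * (2 * r) ^ (CARD('n) - 1)"
    "emeasure lborel S < \<infinity>" "compact S"
proof -
  define l u where "l = (\<chi> j. if j = i then p else - r)" "u = (\<chi> j. if j = i then q else r)"
  have S: "S = cbox l u"
    unfolding S_def l_u_def by (auto simp: mem_box_cart abs_le_iff) (metis minus_le_iff)+
  show "S \<in> sets borel" "emeasure lborel S < \<infinity>" "compact S"
    unfolding S by (simp_all add: emeasure_lborel_cbox_finite[unfolded infinity_ennreal_def])
  have "l \<le> u" using assms by (auto simp: less_eq_vec_def l_u_def)
  then have "measure lborel S = (\<Prod>j\<in>UNIV. u $ j - l $ j)"
    unfolding S using content_cbox_cart[of l u] by (auto simp: interval_ne_empty_cart less_eq_vec_def)
  also have "\<dots> = (u $ i - l $ i) * (\<Prod>j\<in>UNIV - {i}. u $ j - l $ j)"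
    by (rule prod.remove) auto
  also have "(\<Prod>j\<in>UNIV - {i}. u $ j - l $ j) = (\<Prod>j\<in>UNIV - {i}. 2 * r)"
    by (rule prod.cong) (auto simp: l_u_def)
  finally show "measure lborel S = (q - p) * (2 * r) ^ (CARD('n) - 1)"
    by (simp add: l_u_def)
qed

text \<open>The factor multiplying the Jacobi field. It vanishes where
  \<open>cos x\<^sub>i \<le> \<delta>\<close> and where the squared distance from the
  \<open>i\<close>-th axis is at least \<open>2 L\<^sup>2\<close>. Using the cosine and the squared
  distance as arguments keeps it smooth on the whole space.\<close>

definition cutoff :: "'n::finite \<Rightarrow> real \<Rightarrow> real \<Rightarrow> real^'n \<Rightarrow> real" where
  "cutoff i \<delta> L x = flat_exp (cos (x $ i) / \<delta> - 1) * flat_exp (2 - (x \<bullet> x - (x $ i)\<^sup>2) / L\<^sup>2)"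

definition cutoff_gradient :: "'n::finite \<Rightarrow> real \<Rightarrow> real \<Rightarrow> real^'n \<Rightarrow> real^'n" where
  "cutoff_gradient i \<delta> L x =
     (flat_exp' (cos (x $ i) / \<delta> - 1) * (- sin (x $ i) / \<delta>) * flat_exp (2 - (x \<bullet> x - (x $ i)\<^sup>2) / L\<^sup>2)) *\<^sub>R axis i 1
     + (flat_exp (cos (x $ i) / \<delta> - 1) * flat_exp' (2 - (x \<bullet> x - (x $ i)\<^sup>2) / L\<^sup>2) * (- 2 / L\<^sup>2)) *\<^sub>R
       (x - (x $ i) *\<^sub>R axis i 1)"

lemma cutoff_has_derivative:
  assumes "L \<noteq> 0"
  shows "(cutoff i \<delta> L has_derivative (\<lambda>v. cutoff_gradient i \<delta> L x \<bullet> v)) (at x)"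
proof -
  have c: "((\<lambda>x. x $ i) has_derivative (\<lambda>v. v $ i)) (at x)"
    by (rule bounded_linear_imp_has_derivative[OF bounded_linear_component])
  have 1: "((\<lambda>x. cos (x $ i) / \<delta> - 1) has_derivative (\<lambda>v. - sin (x $ i) / \<delta> * v $ i)) (at x)"
    by (rule has_derivative_compose[OF c, of "\<lambda>t. cos t / \<delta> - 1"])
      (auto intro!: derivative_eq_intros simp: has_field_derivative_def[symmetric] divide_inverse)
  have 2: "((\<lambda>x. 2 - (x \<bullet> x - (x $ i)\<^sup>2) / L\<^sup>2) has_derivative
      (\<lambda>v. (- 2 / L\<^sup>2) * (x \<bullet> v - x $ i * v $ i))) (at x)"
    unfolding power2_eq_square[of "_ $ i"]
    by (rule has_derivative_eq_rhs)
      (rule derivative_intros has_derivative_inner has_derivative_mult c refl |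
       use assms in \<open>auto simp: fun_eq_iff inner_commute field_simps\<close>)+
  show ?thesis
    unfolding cutoff_def[abs_def]
    by (rule has_derivative_eq_rhs[OF has_derivative_mult[OF flat_exp_has_derivative_compose[OF 1]
            flat_exp_has_derivative_compose[OF 2]]])
      (auto simp: fun_eq_iff cutoff_gradient_def inner_add_left inner_diff_left inner_axis' algebra_simps)
qed

lemma off_axis_norm:
  fixes x :: "real^'n::finite"
  shows "x \<bullet> x - (x $ i)\<^sup>2 = (\<Sum>j\<in>UNIV - {i}. (x $ j)\<^sup>2)"
  by (simp add: inner_vec_def sum_diff1 power2_eq_square)

lemma smooth_on_cutoff: "smooth_on UNIV (cutoff (i :: 'n::finite) \<delta> L)"
proof -
  note compose = smooth_on_compose[OF open_UNIV open_UNIV subset_UNIV]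
  have c: "smooth_on UNIV (\<lambda>x :: real^'n. x $ j)" for j by (rule smooth_on_component[OF open_UNIV])
  have 1: "smooth_on UNIV (\<lambda>x :: real^'n. (1 / \<delta>) * cos (x $ i) + (- 1))"
    by (intro smooth_on_add smooth_on_mult smooth_on_const open_UNIV compose[OF smooth_on_cos c])
  have "smooth_on UNIV (\<lambda>x :: real^'n. (- 1 / L\<^sup>2) * (\<Sum>j\<in>UNIV - {i}. x $ j * x $ j) + 2)"
    by (intro smooth_on_add smooth_on_mult smooth_on_const smooth_on_sum open_UNIV c)
  then have 2: "smooth_on UNIV (\<lambda>x :: real^'n. (- 1 / L\<^sup>2) * (x \<bullet> x - (x $ i)\<^sup>2) + 2)"
    unfolding off_axis_norm by (simp add: power2_eq_square)
  have "smooth_on UNIV (\<lambda>x. flat_exp ((1 / \<delta>) * cos (x $ i) + (- 1)) *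
      flat_exp ((- 1 / L\<^sup>2) * (x \<bullet> x - (x $ i)\<^sup>2) + 2))"
    by (intro smooth_on_mult open_UNIV compose[OF smooth_on_flat_exp 1] compose[OF smooth_on_flat_exp 2])
  then show ?thesis by (simp add: cutoff_def[abs_def] diff_divide_distrib algebra_simps)
qed

text \<open>The sharp radius \<open>sqrt 2 * L\<close> is rounded up to \<open>2 * L\<close>, so
  that supports fit into boxes with simple side lengths.\<close>

lemma off_axis_component_bound:
  assumes "0 < L" "x \<bullet> x - (x $ i)\<^sup>2 < 2 * L\<^sup>2" "j \<noteq> i"
  shows "\<bar>x $ j\<bar> \<le> 2 * L"
proof -
  have "(x $ j)\<^sup>2 \<le> x \<bullet> x - (x $ i)\<^sup>2"
    unfolding off_axis_norm using assms(3) by (intro member_le_sum) auto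
  also have "\<dots> \<le> (2 * L)\<^sup>2" using assms(2) by (simp add: power_mult_distrib) (smt (verit) zero_le_power2)
  finally show ?thesis
    using assms(1) by (intro power2_le_imp_le[of "\<bar>x $ j\<bar>"]) simp_all
qed

text \<open>The nonzero set lies over a closed box contained in the open slab. The graph map is
  continuous there, so the image of the box is a compact, hence closed, set containing the ambient
  closure of the nonzero set.\<close>

lemma test_function_cutoff:
  fixes i :: "'n::finite"
  assumes \<delta>: "0 < \<delta>" "\<delta> < 1" and L: "0 < L"
  shows "test_function (grim_reaper_hyperplane i) (\<lambda>p. cos (fst p $ i) * cutoff i \<delta> L (fst p))"
    (is "test_function ?\<Sigma> ?f")
  unfolding test_function_def
proof (intro conjI)
  have "smooth_on UNIV (\<lambda>x :: real^'n. cos (x $ i) * cutoff i \<delta> L x)"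
    by (intro smooth_on_mult smooth_on_cutoff open_UNIV
        smooth_on_compose[OF open_UNIV open_UNIV subset_UNIV smooth_on_cos smooth_on_component[OF open_UNIV]])
  then have "smooth_on UNIV ?f"
    by (rule smooth_on_compose[OF open_UNIV open_UNIV subset_UNIV _ smooth_on_bounded_linear[OF bounded_linear_fst open_UNIV]])
  then show "smooth_map_on ?\<Sigma> ?f" unfolding smooth_map_on_def by blast
  have "?f (grim_graph i 0) > 0"
    using \<delta> by (simp add: cutoff_def flat_exp_pos)
  moreover have "grim_graph i 0 \<in> ?\<Sigma>" by (simp add: slab_def)
  ultimately show "\<exists>p\<in>?\<Sigma>. ?f p \<noteq> 0"
    by (intro bexI[of _ "grim_graph i 0"]) auto
  \<comment> \<open>Within the slab, \<open>cos x\<^sub>i > \<delta>\<close> confines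
    \<open>x\<^sub>i\<close> to the interval from \<open>- b\<close> to \<open>b\<close>, which
    stops short of the walls because \<delta> is positive.\<close>
  define b where "b = arccos \<delta>"
  have b: "0 \<le> b" "b < pi / 2" "cos b = \<delta>"
    using \<delta> arccos_less_arccos[of 0 \<delta>] by (auto simp: b_def arccos_lbound cos_arccos)
  define S where "S = {x :: real^'n. - b \<le> x $ i \<and> x $ i \<le> b \<and> (\<forall>j. j \<noteq> i \<longrightarrow> \<bar>x $ j\<bar> \<le> 2 * L)}"
  have S: "compact S" "S \<subseteq> slab i"
    using measure_box_around_axis(4)[of "- b" b "2 * L" i] b L by (auto simp: S_def slab_def)
  then have gS: "compact (grim_graph i ` S)"
    by (intro compact_continuous_image continuous_on_subset[OF smooth_onD_continuous[OF smooth_on_grim_graph]])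
  have sub: "{p \<in> ?\<Sigma>. ?f p \<noteq> 0} \<subseteq> grim_graph i ` S"
  proof
    fix p assume "p \<in> {p \<in> ?\<Sigma>. ?f p \<noteq> 0}"
    then obtain x where p: "p = grim_graph i x" "x \<in> slab i" and c: "cutoff i \<delta> L x \<noteq> 0"
      by (auto simp: grim_reaper_hyperplane_eq)
    have 1: "cos (x $ i) / \<delta> - 1 > 0" and 2: "2 - (x \<bullet> x - (x $ i)\<^sup>2) / L\<^sup>2 > 0"
      using c flat_exp_nonpos unfolding cutoff_def by (metis linorder_not_le mult_eq_0_iff)+
    have "\<bar>x $ j\<bar> \<le> 2 * L" if "j \<noteq> i" for j
      using 2 L by (intro off_axis_component_bound[OF L _ that]) (simp add: field_simps)
    moreover have "\<bar>x $ i\<bar> \<le> b"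
    proof (rule ccontr)
      assume "\<not> \<bar>x $ i\<bar> \<le> b"
      then have "cos \<bar>x $ i\<bar> < cos b"
        using b p(2) by (intro cos_monotone_0_pi) (auto simp: slab_def)
      then show False using 1 \<delta> b(3) by (simp add: field_simps)
    qed
    ultimately show "p \<in> grim_graph i ` S"
      unfolding p S_def by (intro imageI) (auto simp: abs_le_iff)
  qed
  then have "closure {p \<in> ?\<Sigma>. ?f p \<noteq> 0} \<subseteq> grim_graph i ` S"
    using gS by (intro closure_minimal compact_imp_closed)
  then have "?\<Sigma> \<inter> closure {p \<in> ?\<Sigma>. ?f p \<noteq> 0} = grim_graph i ` S \<inter> closure {p \<in> ?\<Sigma>. ?f p \<noteq> 0}"
    using S(2) by (auto simp: grim_reaper_hyperplane_eq)
  then show "compact (?\<Sigma> \<inter> closure {p \<in> ?\<Sigma>. ?f p \<noteq> 0})"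
    by (simp only: compact_Int_closed[OF gS closed_closure])
qed

text \<open>Differentiating the factor \<open>cos x\<^sub>i\<close> produces
  \<open>- sin x\<^sub>i \<eta>\<close>, which \<open>F tan x\<^sub>i\<close> cancels, leaving
  \<open>cos x\<^sub>i\<close> times the \<open>i\<close>-th derivative of the cut-off \<eta>. In
  the other directions \<open>cos x\<^sub>i\<close> cancels against the weight.\<close>

lemma rayleigh_quotient_cutoff:
  fixes i :: "'n::finite"
  assumes \<delta>: "0 < \<delta>" "\<delta> < 1" and L: "0 < L"
  shows "rayleigh_quotient (grim_reaper_hyperplane i) (\<lambda>p. cos (fst p $ i) * cutoff i \<delta> L (fst p)) =
    (\<integral>x. indicator (slab i) x *
      ((flat_exp (cos (x $ i) / \<delta> - 1) * flat_exp' (2 - (x \<bullet> x - (x $ i)\<^sup>2) / L\<^sup>2) * (2 / L\<^sup>2))\<^sup>2 * (x \<bullet> x - (x $ i)\<^sup>2)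
      + (cos (x $ i) / \<delta> * flat_exp' (cos (x $ i) / \<delta> - 1) * sin (x $ i) *
          flat_exp (2 - (x \<bullet> x - (x $ i)\<^sup>2) / L\<^sup>2))\<^sup>2) \<partial>lborel) /
    (\<integral>x. indicator (slab i) x * (cutoff i \<delta> L x)\<^sup>2 \<partial>lborel)"
proof -
  define F where "F x = cos (x $ i) * cutoff i \<delta> L x" for x
  define d where "d x = (- sin (x $ i) * cutoff i \<delta> L x) *\<^sub>R axis i 1 + cos (x $ i) *\<^sub>R cutoff_gradient i \<delta> L x" for x
  have der: "(F has_derivative (\<lambda>v. d x \<bullet> v)) (at x)" for x
  proof -
    have c: "((\<lambda>x. x $ i) has_derivative (\<lambda>v. v $ i)) (at x)"
      by (rule bounded_linear_imp_has_derivative[OF bounded_linear_component])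
    have cos: "((\<lambda>x. cos (x $ i)) has_derivative (\<lambda>v. - sin (x $ i) * v $ i)) (at x)"
      using has_derivative_compose[OF c DERIV_cos[unfolded has_field_derivative_def]] .
    show ?thesis
      unfolding F_def[abs_def]
      by (rule has_derivative_eq_rhs[OF has_derivative_mult[OF cos cutoff_has_derivative]])
        (use L in \<open>auto simp: fun_eq_iff d_def inner_add_left inner_axis' algebra_simps\<close>)
  qed
  have cont: "continuous_on UNIV d"
    unfolding d_def[abs_def] cutoff_gradient_def cutoff_def using \<delta> L
    by (intro continuous_intros continuous_on_compose2[OF continuous_on_flat_exp(1)]
        continuous_on_compose2[OF continuous_on_flat_exp(2)]) auto
  have rayleigh: "rayleigh_quotient (grim_reaper_hyperplane i) (\<lambda>p. cos (fst p $ i) * cutoff i \<delta> L (fst p)) =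
    (\<integral>x. indicator (slab i) x * ((d x \<bullet> d x - (d x $ i)\<^sup>2) / (cos (x $ i))\<^sup>2 +
       (d x $ i + F x * tan (x $ i))\<^sup>2) \<partial>lborel) /
    (\<integral>x. indicator (slab i) x * (F x / cos (x $ i))\<^sup>2 \<partial>lborel)"
  proof (rule rayleigh_quotient_grim_reaper)
    show "continuous_on (slab i) d" by (rule continuous_on_subset[OF cont]) simp
    show "(F has_derivative (\<lambda>v. d x \<bullet> v)) (at x)" for x by (rule der)
  qed (simp add: F_def, rule test_function_cutoff[OF assms])
  show ?thesis
    unfolding rayleigh
  proof (intro arg_cong2[of _ _ _ _ "(/)"] Bochner_Integration.integral_cong refl)
    fix x :: "real^'n"
    define \<rho> where "\<rho> = x \<bullet> x - (x $ i)\<^sup>2"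
    define A where "A = flat_exp (cos (x $ i) / \<delta> - 1)"
    define A' where "A' = flat_exp' (cos (x $ i) / \<delta> - 1)"
    define B where "B = flat_exp (2 - \<rho> / L\<^sup>2)"
    define B' where "B' = flat_exp' (2 - \<rho> / L\<^sup>2)"
    define y where "y = x - (x $ i) *\<^sub>R axis i 1"
    define c where "c = cos (x $ i)"
    define s where "s = sin (x $ i)"
    have y: "y $ i = 0" "y \<bullet> y = \<rho>" "axis i 1 \<bullet> y = 0"
      by (auto simp: y_def \<rho>_def inner_diff_left inner_diff_right inner_axis inner_axis' power2_eq_square)
    \<comment> \<open>The vector \<open>y\<close> is orthogonal to the axis, so by Pythagoras
      removing the square of the \<open>i\<close>-th component leaves only a multiple of
      \<open>\<rho>\<close>.\<close>
    have d: "d x = (- s * (A * B) - c * (A' * (s / \<delta>) * B)) *\<^sub>R axis i 1 - (c * (A * B' * (2 / L\<^sup>2))) *\<^sub>R y"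
      by (simp add: d_def cutoff_def cutoff_gradient_def A_def A'_def B_def B'_def \<rho>_def y_def c_def s_def algebra_simps)
    have di: "d x $ i = - s * (A * B) - c * (A' * (s / \<delta>) * B)"
      by (simp add: d y)
    have dd: "d x \<bullet> d x - (d x $ i)\<^sup>2 = (c * (A * B' * (2 / L\<^sup>2)))\<^sup>2 * \<rho>"
    proof -
      have "(\<alpha> *\<^sub>R axis i 1 - \<beta> *\<^sub>R y) \<bullet> (\<alpha> *\<^sub>R axis i 1 - \<beta> *\<^sub>R y) = \<alpha>\<^sup>2 + \<beta>\<^sup>2 * \<rho>" for \<alpha> \<beta>
        using y inner_commute[of y "axis i 1"]
        by (simp add: inner_diff_left inner_diff_right inner_axis_axis power2_eq_square)
      then show ?thesis unfolding di unfolding d by simp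
    qed
    have F: "F x = c * (A * B)" by (simp add: F_def cutoff_def A_def B_def \<rho>_def c_def)
    have "(d x \<bullet> d x - (d x $ i)\<^sup>2) / c\<^sup>2 + (d x $ i + F x * tan (x $ i))\<^sup>2 =
        (A * B' * (2 / L\<^sup>2))\<^sup>2 * \<rho> + (c / \<delta> * A' * s * B)\<^sup>2" if "x \<in> slab i"
    proof -
      have c: "c \<noteq> 0" using cos_slab_pos[OF that] by (simp add: c_def)
      have "d x $ i + F x * tan (x $ i) = - (c / \<delta> * A' * s * B)"
        unfolding di F tan_def c_def[symmetric] s_def[symmetric] using c by (simp add: field_simps)
      moreover have "(d x \<bullet> d x - (d x $ i)\<^sup>2) / c\<^sup>2 = (A * B' * (2 / L\<^sup>2))\<^sup>2 * \<rho>"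
        unfolding dd power_mult_distrib[of c] using c by simp
      ultimately show ?thesis by simp
    qed
    then show "indicator (slab i) x * ((d x \<bullet> d x - (d x $ i)\<^sup>2) / (cos (x $ i))\<^sup>2 +
       (d x $ i + F x * tan (x $ i))\<^sup>2) = indicator (slab i) x *
      ((flat_exp (cos (x $ i) / \<delta> - 1) * flat_exp' (2 - (x \<bullet> x - (x $ i)\<^sup>2) / L\<^sup>2) * (2 / L\<^sup>2))\<^sup>2 * (x \<bullet> x - (x $ i)\<^sup>2)
      + (cos (x $ i) / \<delta> * flat_exp' (cos (x $ i) / \<delta> - 1) * sin (x $ i) *
          flat_exp (2 - (x \<bullet> x - (x $ i)\<^sup>2) / L\<^sup>2))\<^sup>2)"
      unfolding A_def A'_def B_def B'_def \<rho>_def c_def s_def by (auto simp: indicator_def)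
    show "indicator (slab i) x * (F x / cos (x $ i))\<^sup>2 = indicator (slab i) x * (cutoff i \<delta> L x)\<^sup>2"
      using cos_slab_pos[of x i] by (auto simp: F_def indicator_def)
  qed
qed

text \<open>\<open>a\<close> leaves a strip of width \<open>1 / k\<close> at each wall, and
  \<open>\<delta>\<close> is tuned so that the argument of the slab cut-off is at least
  \<open>k\<close> between the strips. There the whole energy density is of order
  \<open>1 / k\<^sup>2\<close>. On the strips it is merely bounded, and their width will supply the
  factor \<open>1 / k\<close>.\<close>

lemma cutoff_energy_bound:
  fixes x :: "real^'n::finite" and k :: real and i :: 'n
  defines "a \<equiv> pi / 2 - 1 / k"
  defines "\<delta> \<equiv> cos a / (k + 1)"
  defines "\<rho> \<equiv> x \<bullet> x - (x $ i)\<^sup>2"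
  defines "S \<equiv> \<lambda>p q. {x :: real^'n. p \<le> x $ i \<and> x $ i \<le> q \<and> (\<forall>j. j \<noteq> i \<longrightarrow> \<bar>x $ j\<bar> \<le> 2 * k)}"
  assumes k: "k \<ge> 2" and x: "x \<in> slab i"
  shows "(flat_exp (cos (x $ i) / \<delta> - 1) * flat_exp' (2 - \<rho> / k\<^sup>2) * (2 / k\<^sup>2))\<^sup>2 * \<rho>
      + (cos (x $ i) / \<delta> * flat_exp' (cos (x $ i) / \<delta> - 1) * sin (x $ i) * flat_exp (2 - \<rho> / k\<^sup>2))\<^sup>2
    \<le> 36 / k\<^sup>2 * indicator (S (- pi / 2) (pi / 2)) x + 4 * indicator (S a (pi / 2)) x
      + 4 * indicator (S (- pi / 2) (- a)) x" (is "?T1 + ?T2 \<le> ?R")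
proof (cases "2 - \<rho> / k\<^sup>2 \<le> 0")
  case True
  then show ?thesis by simp
next
  case False
  have \<rho>0: "\<rho> \<ge> 0" unfolding \<rho>_def off_axis_norm by (intro sum_nonneg) simp
  have \<rho>: "\<rho> < 2 * k\<^sup>2" using False k by (simp add: field_simps)
  have bound: "\<bar>x $ j\<bar> \<le> 2 * k" if "j \<noteq> i" for j
    using \<rho> k that unfolding \<rho>_def by (intro off_axis_component_bound[of k x i]) auto
  have xi: "- pi / 2 < x $ i" "x $ i < pi / 2" using x by (auto simp: slab_def)
  have a: "0 < a" "a < pi / 2"
  proof -
    have "1 / k \<le> 1 / 2" using k by (simp add: field_simps)
    then show "0 < a" unfolding a_def using pi_gt3 by simp
  qed (use k in \<open>simp add: a_def\<close>)
  then have ca: "0 < cos a" by (intro cos_gt_zero) auto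
  then have \<delta>: "0 < \<delta>" using k by (simp add: \<delta>_def)
  have c: "0 < cos (x $ i)" by (rule cos_slab_pos[OF x])
  define t where "t = cos (x $ i) / \<delta> - 1"
  have t1: "cos (x $ i) / \<delta> = t + 1" "0 < t + 1" using c \<delta> by (simp_all add: t_def)
  \<comment> \<open>\<open>32 = 4\<^sup>2 * 2\<close>: the factor that gets squared is at most
    \<open>4 / k\<^sup>2\<close>, and \<open>\<rho> < 2 * k\<^sup>2\<close> on the support.\<close>
  have T1: "?T1 \<le> 32 / k\<^sup>2"
  proof -
    have "flat_exp (cos (x $ i) / \<delta> - 1) * flat_exp' (2 - \<rho> / k\<^sup>2) \<le> 1 * 2"
      by (intro mult_mono flat_exp_bounds flat_exp'_le_2) auto
    then have "flat_exp (cos (x $ i) / \<delta> - 1) * flat_exp' (2 - \<rho> / k\<^sup>2) * (2 / k\<^sup>2) \<le> 2 * (2 / k\<^sup>2)"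
      by (intro mult_right_mono) auto
    then have "(flat_exp (cos (x $ i) / \<delta> - 1) * flat_exp' (2 - \<rho> / k\<^sup>2) * (2 / k\<^sup>2))\<^sup>2 \<le> (2 * (2 / k\<^sup>2))\<^sup>2"
      by (intro power_mono mult_nonneg_nonneg flat_exp_bounds) auto
    then have "?T1 \<le> (2 * (2 / k\<^sup>2))\<^sup>2 * (2 * k\<^sup>2)"
      using \<rho> \<rho>0 by (intro mult_mono) auto
    also have "\<dots> = 32 / k\<^sup>2" using k by (simp add: field_simps power2_eq_square)
    finally show ?thesis .
  qed
  have T2: "?T2 \<le> M\<^sup>2" if "(t + 1) * flat_exp' t \<le> M" for M
  proof -
    have "\<bar>cos (x $ i) / \<delta> * flat_exp' (cos (x $ i) / \<delta> - 1) * sin (x $ i) * flat_exp (2 - \<rho> / k\<^sup>2)\<bar>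
        = (t + 1) * flat_exp' t * (\<bar>sin (x $ i)\<bar> * flat_exp (2 - \<rho> / k\<^sup>2))"
      unfolding t_def[symmetric] t1(1) using t1(2) flat_exp_bounds by (simp add: abs_mult)
    also have "\<dots> \<le> M * (1 * 1)"
      using that t1(2) flat_exp_bounds order_trans[OF mult_nonneg_nonneg that]
      by (intro mult_mono mult_nonneg_nonneg) auto
    finally show ?thesis by (simp add: abs_le_square_iff[symmetric])
  qed
  have in0: "x \<in> S (- pi / 2) (pi / 2)" using bound xi by (simp add: S_def)
  show ?thesis
  proof (cases "\<bar>x $ i\<bar> \<le> a")
    case True
    \<comment> \<open>Cosine decreases away from the axis, so its smallest value in this region is
      \<open>cos a\<close>, which is \<open>(k + 1) * \<delta>\<close> by the choice of
      \<open>\<delta>\<close>.\<close>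
    have "cos a \<le> cos \<bar>x $ i\<bar>" using True a by (intro cos_monotone_0_pi_le) auto
    moreover have "(k + 1) * \<delta> = cos a" using k by (simp add: \<delta>_def)
    ultimately have "k + 1 \<le> cos (x $ i) / \<delta>" using \<delta> by (simp add: pos_le_divide_eq)
    then have "(t + 1) * flat_exp' t \<le> 2 / k" using k by (intro flat_exp'_decay) (auto simp: t_def)
    then have "?T2 \<le> 4 / k\<^sup>2" using T2 by (fastforce simp: power_divide)
    then have "?T1 + ?T2 \<le> 36 / k\<^sup>2" using T1 by (simp add: add_divide_distrib[symmetric])
    also have "\<dots> \<le> ?R" using in0 by simp
    finally show ?thesis .
  next
    case False
    then have "x \<in> S a (pi / 2) \<or> x \<in> S (- pi / 2) (- a)"
      using bound xi by (auto simp: S_def)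
    moreover have "(t + 1) * flat_exp' t \<le> 2"
      using flat_exp'_le_2(1)[of t] by (cases "t \<ge> 0") auto
    then have "?T2 \<le> 4" using T2[of 2] by simp
    moreover have "32 / k\<^sup>2 \<le> 36 / k\<^sup>2" by (intro divide_right_mono) auto
    ultimately show ?thesis using T1 in0 by (auto simp: indicator_def)
  qed
qed

text \<open>The numerator is at most a multiple of \<open>1 / k\<close> times the volume of a box
  whose free sides are proportional to \<open>k\<close>. The denominator is bounded below on a
  smaller box with free sides also proportional to \<open>k\<close>. The powers of \<open>k\<close>
  cancel, so only \<open>1 / k\<close> remains.\<close>

lemma rayleigh_quotient_small:
  fixes i :: "'n::finite"
  shows "\<exists>C. \<forall>k\<ge>2::nat.
    (\<exists>f. test_function (grim_reaper_hyperplane i) f \<and>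
         rayleigh_quotient (grim_reaper_hyperplane i) f \<le> C / real k)"
proof -
  define m where "m = CARD('n) - 1"
  \<comment> \<open>The full dimension serves as the divisor in \<open>k / n\<close> below, because
    the number \<open>m\<close> of free directions is 0 when \<open>'n\<close> has one
    element.\<close>
  define n where "n = real CARD('n)"
  define e where "e = flat_exp 1"
  have n: "n \<ge> 1" unfolding n_def by (simp add: Suc_leI)
  have e: "e > 0" by (simp add: e_def flat_exp_pos)
  \<comment> \<open>\<open>76 = 152 / 2\<close>, the 2 being the height of the inner box;
    \<open>2 * n\<close> is the ratio of the free sides \<open>4 * k\<close> and
    \<open>2 * k / n\<close>; \<open>e ^ 4\<close> is the lower bound for the squared cut-off on the
    inner box.\<close>
  define C where "C = 76 * (2 * n) ^ m / e ^ 4"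
  show ?thesis
  proof (intro exI[of _ C] allI impI)
    fix k' :: nat assume k': "(2::nat) \<le> k'"
    define k where "k = real k'"
    have k: "k \<ge> 2" using k' by (simp add: k_def)
    define a where "a = pi / 2 - 1 / k"
    define \<delta> where "\<delta> = cos a / (k + 1)"
    define S where "S p q = {x :: real^'n. p \<le> x $ i \<and> x $ i \<le> q \<and> (\<forall>j. j \<noteq> i \<longrightarrow> \<bar>x $ j\<bar> \<le> 2 * k)}" for p q
    \<comment> \<open>A box on which both arguments of \<open>flat_exp\<close> are at least 1. At
      most \<open>n\<close> squares of size \<open>(k / n)\<^sup>2\<close> add up to no more than
      \<open>k\<^sup>2\<close>, and \<open>\<bar>x $ i\<bar> \<le> 1\<close> keeps the point between
      the strips since \<open>a \<ge> 1\<close>.\<close>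
    define S0 where "S0 = {x :: real^'n. - 1 \<le> x $ i \<and> x $ i \<le> 1 \<and> (\<forall>j. j \<noteq> i \<longrightarrow> \<bar>x $ j\<bar> \<le> k / n)}"
    have k12: "1 / k \<le> 1 / 2" using k by (simp add: field_simps)
    have "1 / k > 0" using k by simp
    with k12 have a: "1 \<le> a" "a < pi / 2" unfolding a_def using pi_gt3 by linarith+
    have ca: "0 < cos a" using a by (intro cos_gt_zero) auto
    have "cos a < k + 1" using cos_le_one[of a] k by linarith
    then have \<delta>: "0 < \<delta>" "\<delta> < 1"
      using ca k by (auto simp: \<delta>_def field_simps)
    have S: "S p q \<in> sets borel" "measure lborel (S p q) = (q - p) * (4 * k) ^ m"
      "integrable lborel (\<lambda>x. indicator (S p q) x :: real)" if "p \<le> q" for p q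
      using measure_box_around_axis[OF that, of "2 * k" i] k
      by (auto simp: S_def m_def intro!: integrable_real_indicator)
    have S0: "S0 \<in> sets borel" "measure lborel S0 = 2 * (2 * (k / n)) ^ m"
      "integrable lborel (\<lambda>x. indicator S0 x :: real)"
      using measure_box_around_axis[of "- 1" 1 "k / n" i] k n
      by (auto simp: S0_def m_def intro!: integrable_real_indicator)
    define Q where "Q x = indicator (slab i) x *
      ((flat_exp (cos (x $ i) / \<delta> - 1) * flat_exp' (2 - (x \<bullet> x - (x $ i)\<^sup>2) / k\<^sup>2) * (2 / k\<^sup>2))\<^sup>2 * (x \<bullet> x - (x $ i)\<^sup>2)
      + (cos (x $ i) / \<delta> * flat_exp' (cos (x $ i) / \<delta> - 1) * sin (x $ i) *
          flat_exp (2 - (x \<bullet> x - (x $ i)\<^sup>2) / k\<^sup>2))\<^sup>2)" for x :: "real^'n"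
    let ?R = "\<lambda>x. 36 / k\<^sup>2 * indicator (S (- pi / 2) (pi / 2)) x + 4 * indicator (S a (pi / 2)) x
      + 4 * indicator (S (- pi / 2) (- a)) x"
    have R: "integrable lborel ?R"
      using a S(3) by (intro Bochner_Integration.integrable_add integrable_mult_right) auto
    have "(\<integral>x. Q x \<partial>lborel) \<le> (\<integral>x. ?R x \<partial>lborel)"
    proof (rule integral_mono'[OF R])
      fix x
      show "Q x \<le> ?R x"
        using cutoff_energy_bound[OF k, of x i]
        by (cases "x \<in> slab i") (simp_all add: Q_def S_def a_def \<delta>_def)
    qed simp
    also have "\<dots> = 36 / k\<^sup>2 * (pi * (4 * k) ^ m) + 4 * ((1 / k) * (4 * k) ^ m) + 4 * ((1 / k) * (4 * k) ^ m)"
      using a S by (simp add: a_def Bochner_Integration.integral_add)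
    also have "\<dots> = (36 * pi / k\<^sup>2 + 8 / k) * (4 * k) ^ m"
      using k by (simp add: field_simps)
    \<comment> \<open>\<open>152 = 144 + 8\<close>, with \<open>36 * pi < 144\<close> and one factor
      \<open>1 / k\<close> given away.\<close>
    also have "\<dots> \<le> (152 / k) * (4 * k) ^ m"
    proof (intro mult_right_mono)
      have "36 * pi / k\<^sup>2 \<le> 144 / k\<^sup>2" using pi_less_4 by (intro divide_right_mono) auto
      also have "\<dots> \<le> 144 / k" using k by (simp add: field_simps power2_eq_square)
      finally show "36 * pi / k\<^sup>2 + 8 / k \<le> 152 / k" by simp
    qed (use k in simp)
    finally have num: "(\<integral>x. Q x \<partial>lborel) \<le> (152 / k) * (4 * k) ^ m" .
    define D where "D x = indicator (slab i) x * (cutoff i \<delta> k x)\<^sup>2" for x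
    have cut01: "0 \<le> cutoff i \<delta> k x" "cutoff i \<delta> k x \<le> 1" for x
      unfolding cutoff_def using flat_exp_bounds by (auto intro: mult_le_one)
    \<comment> \<open>A non-integrable \<open>D\<close> would have integral 0 by convention, so the
      lower bound for the denominator rests on this.\<close>
    have D_int: "integrable lborel D"
    proof (rule Bochner_Integration.integrable_bound)
      show "integrable lborel (\<lambda>x. indicator (S (- pi / 2) (pi / 2)) x :: real)" by (rule S) simp
      have "cutoff i \<delta> k \<in> borel_measurable borel"
        by (rule borel_measurable_continuous_onI[OF smooth_onD_continuous[OF smooth_on_cutoff]])
      then show "D \<in> borel_measurable lborel" unfolding D_def[abs_def] by simp
      have "\<bar>D x\<bar> \<le> indicator (S (- pi / 2) (pi / 2)) x" for x
      proof (cases "x \<in> S (- pi / 2) (pi / 2) \<or> x \<notin> slab i")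
        case True
        then show ?thesis using cut01[of x] by (auto simp: D_def indicator_def power_le_one)
      next
        case False
        then obtain j where j: "j \<noteq> i" "\<not> \<bar>x $ j\<bar> \<le> 2 * k" by (auto simp: S_def slab_def)
        have "\<not> x \<bullet> x - (x $ i)\<^sup>2 < 2 * k\<^sup>2"
          using off_axis_component_bound[of k x i j] j k by auto
        then have "cutoff i \<delta> k x = 0"
          unfolding cutoff_def using k by (simp add: field_simps)
        then show ?thesis by (simp add: D_def)
      qed
      then show "AE x in lborel. norm (D x) \<le> norm (indicator (S (- pi / 2) (pi / 2)) x :: real)" by simp
    qed
    have "e ^ 4 * measure lborel S0 = (\<integral>x. e ^ 4 * indicator S0 x \<partial>lborel)"
      using S0 by simp
    also have "\<dots> \<le> (\<integral>x. D x \<partial>lborel)"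
    proof (rule integral_mono'[OF D_int])
      fix x
      show "e ^ 4 * indicator S0 x \<le> D x"
      proof (cases "x \<in> S0")
        case True
        have xi: "\<bar>x $ i\<bar> \<le> 1" using True by (auto simp: S0_def)
        then have slab: "x \<in> slab i" unfolding slab_def using pi_gt3 by auto
        have "cos a \<le> cos \<bar>x $ i\<bar>" using xi a by (intro cos_monotone_0_pi_le) auto
        moreover have "(k + 1) * \<delta> = cos a" using k by (simp add: \<delta>_def)
        ultimately have "k + 1 \<le> cos (x $ i) / \<delta>" using \<delta>(1) by (simp add: pos_le_divide_eq)
        then have "1 \<le> cos (x $ i) / \<delta> - 1" using k by linarith
        then have 1: "e \<le> flat_exp (cos (x $ i) / \<delta> - 1)" unfolding e_def by (rule flat_exp_mono)
        have "x \<bullet> x - (x $ i)\<^sup>2 \<le> (\<Sum>j\<in>UNIV - {i}. (k / n)\<^sup>2)"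
          unfolding off_axis_norm using True k n
          by (intro sum_mono) (auto simp: S0_def abs_le_square_iff[symmetric])
        also have "\<dots> \<le> n * (k / n)\<^sup>2" by (simp add: n_def mult_right_mono)
        also have "\<dots> = k\<^sup>2 / n" using n by (simp add: power2_eq_square)
        also have "\<dots> \<le> k\<^sup>2" using n mult_right_mono[of 1 n "k\<^sup>2"] by (simp add: field_simps)
        finally have "1 \<le> 2 - (x \<bullet> x - (x $ i)\<^sup>2) / k\<^sup>2" using k by (simp add: field_simps)
        then have 2: "e \<le> flat_exp (2 - (x \<bullet> x - (x $ i)\<^sup>2) / k\<^sup>2)" unfolding e_def by (rule flat_exp_mono)
        have "(e * e)\<^sup>2 \<le> (cutoff i \<delta> k x)\<^sup>2"
          unfolding cutoff_def using 1 2 e by (intro power_mono mult_mono) auto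
        also have "(e * e)\<^sup>2 = e ^ 4" by (simp add: eval_nat_numeral)
        finally show ?thesis using True slab by (simp add: D_def)
      qed (simp add: D_def)
    qed (simp add: D_def)
    finally have den: "e ^ 4 * (2 * (2 * (k / n)) ^ m) \<le> (\<integral>x. D x \<partial>lborel)" unfolding S0(2) .
    have pos: "0 < e ^ 4 * (2 * (2 * (k / n)) ^ m)" using e k n by simp
    have "(\<integral>x. Q x \<partial>lborel) / (\<integral>x. D x \<partial>lborel) \<le>
        ((152 / k) * (4 * k) ^ m) / (e ^ 4 * (2 * (2 * (k / n)) ^ m))"
      by (rule frac_le[OF _ num pos den]) (use k in simp)
    also have "(4 * k) ^ m = (2 * n) ^ m * (2 * (k / n)) ^ m"
    proof -
      have "4 * k = (2 * n) * (2 * (k / n))" using n by simp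
      then show ?thesis by (simp only: power_mult_distrib[symmetric])
    qed
    also have "((152 / k) * ((2 * n) ^ m * (2 * (k / n)) ^ m)) / (e ^ 4 * (2 * (2 * (k / n)) ^ m)) = C / k"
    proof -
      have "(2 * (k / n)) ^ m \<noteq> 0" using k n by simp
      then show ?thesis unfolding C_def using e k by (simp add: field_simps)
    qed
    finally have "(\<integral>x. Q x \<partial>lborel) / (\<integral>x. D x \<partial>lborel) \<le> C / k" .
    moreover have "rayleigh_quotient (grim_reaper_hyperplane i) (\<lambda>p. cos (fst p $ i) * cutoff i \<delta> k (fst p)) =
        (\<integral>x. Q x \<partial>lborel) / (\<integral>x. D x \<partial>lborel)"
      unfolding Q_def D_def by (rule rayleigh_quotient_cutoff[OF \<delta>]) (use k in simp)
    moreover have "test_function (grim_reaper_hyperplane i) (\<lambda>p. cos (fst p $ i) * cutoff i \<delta> k (fst p))"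
      by (rule test_function_cutoff[OF \<delta>]) (use k in simp)
    ultimately show "\<exists>f. test_function (grim_reaper_hyperplane i) f \<and>
         rayleigh_quotient (grim_reaper_hyperplane i) f \<le> C / real k'"
      unfolding k_def by (metis (no_types, lifting))
  qed
qed

theorem theorem1p5:
  fixes i :: "'n::finite"
  shows "spectrum_bottom (grim_reaper_hyperplane i) = 0"
proof (rule antisym)
  let ?\<mu> = "spectrum_bottom (grim_reaper_hyperplane i)"
  show "0 \<le> ?\<mu>"
    unfolding spectrum_bottom_def by (rule INF_greatest) (simp add: rayleigh_quotient_grim_reaper_nonneg)
  obtain C where C: "\<And>k. (2::nat) \<le> k \<Longrightarrow> \<exists>f. test_function (grim_reaper_hyperplane i) f \<and>
      rayleigh_quotient (grim_reaper_hyperplane i) f \<le> C / real k"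
    using rayleigh_quotient_small[of i] by blast
  have "?\<mu> \<le> ereal (C / real k)" if k: "(2::nat) \<le> k" for k
  proof -
    from C[OF k] obtain f where f: "test_function (grim_reaper_hyperplane i) f"
      "rayleigh_quotient (grim_reaper_hyperplane i) f \<le> C / real k" by blast
    have "?\<mu> \<le> ereal (rayleigh_quotient (grim_reaper_hyperplane i) f)"
      unfolding spectrum_bottom_def by (rule INF_lower) (use f in simp)
    also have "\<dots> \<le> ereal (C / real k)" using f by simp
    finally show ?thesis .
  qed
  moreover have "(\<lambda>k. ereal (C / real k)) \<longlonglongrightarrow> ereal 0"
    by (intro tendsto_intros lim_const_over_n)
  ultimately show "?\<mu> \<le> 0"
    by (intro LIMSEQ_le_const[of "\<lambda>k. ereal (C / real k)"]) (auto simp: zero_ereal_def)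
qed

end
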